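(* Let $K$ be a field, let $R$ be a positively graded $K$-algebra, and let $M=\bigoplus_{i\in\mathbb{Z}}M_i$ be a finitely generated graded $R$-module of dimension $d$. Let $$Q(n)=a_{d-1}(n)n^{d-1}+a_{d-2}(n)n^{d-2}+\cdots+a_1(n)n+a_0(n)$$ be the Hilbert quasi-polynomial of $M$, with period $\pi$. Let $I$ be the ideal of $R$ generated by all homogeneous elements $x$ of $R$ such that $\gcd(\deg x,\pi)=1$. Then $$\operatorname{grade} Q<\dim M/IM .$$
   Context: A positively graded $K$-algebra is a commutative graded ring $R=\bigoplus_{i\ge 0}R_i$ with $R_0=K$ that is finitely generated as a $K$-algebra; it is not assumed to be generated in degree $1$, and the generators may be of arbitrarily high degree. The Hilbert function of $M$ is $H(M,n)=\dim_K M_n$ for $n\in\mathbb{Z}$. The dimension $\dim$ of a module is its Krull dimension. A function $Q:\mathbb{Z}\to\mathbb{C}$ is a quasi-polynomial of degree $u$ if $Q(n)=a_u(n)n^u+a_{u-1}(n)n^{u-1}+\cdots+a_1(n)n+a_0(n)$, where $a_i:\mathbb{Z}\to\mathbb{C}$ is a periodic function for $i=0,\dots,u$ and $a_u\ne 0$. The period of $Q$ is the smallest positive integer $\pi$ such that $a_i(n+m\pi)=a_i(n)$ for all $n,m\in\mathbb{Z}$ and $i=0,\dots,u$. The grade of $Q$, $\operatorname{grade} Q$, is the smallest integer $\delta\ge -1$ such that the function $a_i$ is constant for all $i>\delta$. By the Hilbert–Serre theorem, for $M$ as in the statement there is a quasi-polynomial $Q=Q_M$ of degree $d-1$ with $H(M,n)=Q(n)$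 for all sufficiently large $n$; it is called the Hilbert quasi-polynomial of $M$.
   Formalization: I is generated by homogeneous elements of positive degree prime to π, and M is nonzero; for π = 1 the literal I contains 1, so M/IM = 0 and the claim fails (e.g. R = M = K[x], deg x = 1), as it does for M = 0. *)

theory Defs
  imports Complex_Main "HOL-Library.Extended_Real" "HOL-Library.Set_Algebras"
begin

definition internal_direct_sum :: "('i \<Rightarrow> 'a::ab_group_add set) \<Rightarrow> bool" where
  "internal_direct_sum A \<longleftrightarrow>
     (\<forall>i. 0 \<in> A i \<and> (\<forall>x\<in>A i. \<forall>y\<in>A i. x - y \<in> A i)) \<and>
     (\<forall>x. \<exists>!c. (\<forall>i. c i \<in> A i) \<and> finite {i. c i \<noteq> 0} \<and> x = (\<Sum>i | c i \<noteq> 0. c i))"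

definition subalgebra :: "('k::field \<Rightarrow> 'r::comm_ring_1 \<Rightarrow> 'r) \<Rightarrow> 'r set \<Rightarrow> bool" where
  "subalgebra kscale S \<longleftrightarrow>
     module.subspace kscale S \<and> 1 \<in> S \<and> (\<forall>x\<in>S. \<forall>y\<in>S. x * y \<in> S)"

text \<open>
  The ring is the whole type \<open>'r\<close>, and \<open>R i\<close> is its component of degree \<open>i\<close>.
  The field \<open>'k\<close> is identified with its image \<open>{c \<cdot> 1}\<close> in the ring; the map
  \<open>c \<mapsto> c \<cdot> 1\<close> is injective because \<open>0 \<noteq> 1\<close> in the class \<open>comm_ring_1\<close>.
\<close>

locale positively_graded_algebra = vector_space kscale
  for kscale :: "'k::field \<Rightarrow> 'r::comm_ring_1 \<Rightarrow> 'r" +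
  fixes R :: "nat \<Rightarrow> 'r set"
  assumes scale_mult: "kscale c (x * y) = kscale c x * y"
    and ring_decomposition: "internal_direct_sum R"
    and ring_mult_degree: "x \<in> R i \<Longrightarrow> y \<in> R j \<Longrightarrow> x * y \<in> R (i + j)"
    and degree_zero: "R 0 = range (\<lambda>c. kscale c 1)"
    and finitely_generated_algebra: "\<exists>G. finite G \<and> subalgebra kscale hull G = UNIV"

locale fg_graded_module = positively_graded_algebra kscale R + M: module rscale
  for kscale :: "'k::field \<Rightarrow> 'r::comm_ring_1 \<Rightarrow> 'r" and R :: "nat \<Rightarrow> 'r set"
    and rscale :: "'r \<Rightarrow> 'm::ab_group_add \<Rightarrow> 'm" +
  fixes M :: "int \<Rightarrow> 'm set"
  assumes module_decomposition: "internal_direct_sum M"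
    and module_mult_degree: "r \<in> R i \<Longrightarrow> x \<in> M j \<Longrightarrow> rscale r x \<in> M (int i + j)"
    and finitely_generated_module: "\<exists>G. finite G \<and> M.span G = UNIV"

text \<open>The field acts on the module through its image in the ring.\<close>

definition hilbert_function ::
  "('k::field \<Rightarrow> 'r::comm_ring_1 \<Rightarrow> 'r) \<Rightarrow> ('r \<Rightarrow> 'm::ab_group_add \<Rightarrow> 'm) \<Rightarrow> (int \<Rightarrow> 'm set)
     \<Rightarrow> int \<Rightarrow> nat" where
  "hilbert_function kscale rscale M n = vector_space.dim (\<lambda>c. rscale (kscale c 1)) (M n)"

definition prime_ideal :: "'r::comm_ring_1 set \<Rightarrow> bool" where
  "prime_ideal P \<longleftrightarrow>
     module.subspace (*) P \<and> P \<noteq> UNIV \<and> (\<forall>x y. x * y \<in> P \<longrightarrow> x \<in> P \<or> y \<in> P)"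

text \<open>
  Modules whose dimension is taken are given by scalar multiplication, carrier and zero,
  so that quotient modules, whose elements are cosets, are covered.
\<close>

definition annihilator :: "('r \<Rightarrow> 'n \<Rightarrow> 'n) \<Rightarrow> 'n set \<Rightarrow> 'n \<Rightarrow> 'r set" where
  "annihilator scale N z = {r. \<forall>x\<in>N. scale r x = z}"

text \<open>
  The Krull dimension of a module is that of the ring modulo the annihilator, whose prime
  ideals are the prime ideals containing the annihilator. The zero module has dimension
  \<open>-\<infinity>\<close>, the supremum of the empty set.
\<close>

definition krull_dim :: "('r::comm_ring_1 \<Rightarrow> 'n \<Rightarrow> 'n) \<Rightarrow> 'n set \<Rightarrow> 'n \<Rightarrow> ereal" where
  "krull_dim scale N z = (SUP l \<in> {l :: nat. \<exists>P :: nat \<Rightarrow> 'r set.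
       (\<forall>i\<le>l. prime_ideal (P i) \<and> annihilator scale N z \<subseteq> P i) \<and>
       (\<forall>i<l. P i \<subset> P (Suc i))}. ereal (real l))"

definition ideal_times_module ::
  "('r::comm_ring_1 \<Rightarrow> 'm::ab_group_add \<Rightarrow> 'm) \<Rightarrow> 'r set \<Rightarrow> 'm set" where
  "ideal_times_module scale I = module.span scale {scale r x | r x. r \<in> I}"

definition quotient_carrier :: "'m::ab_group_add set \<Rightarrow> 'm set set" where
  "quotient_carrier N = range (\<lambda>x. x +o N)"

text \<open>On cosets this is \<open>r \<cdot> (x + N) = r \<cdot> x + N\<close>.\<close>

definition quotient_scale ::
  "('r::comm_ring_1 \<Rightarrow> 'm::ab_group_add \<Rightarrow> 'm) \<Rightarrow> 'm set \<Rightarrow> 'r \<Rightarrow> 'm set \<Rightarrow> 'm set" where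
  "quotient_scale scale N r X = scale r ` X + N"

definition krull_dim_quotient ::
  "('r::comm_ring_1 \<Rightarrow> 'm::ab_group_add \<Rightarrow> 'm) \<Rightarrow> 'm set \<Rightarrow> ereal" where
  "krull_dim_quotient scale N = krull_dim (quotient_scale scale N) (quotient_carrier N) N"

lemma quotient_scale_coset:
  assumes "module scale" and N: "module.subspace scale N"
  shows "quotient_scale scale N r (x +o N) = scale r x +o N"
proof -
  interpret module scale by fact
  show ?thesis
  proof (intro equalityI subsetI)
    fix y assume "y \<in> quotient_scale scale N r (x +o N)"
    then obtain m n where mn: "m \<in> N" "n \<in> N" "y = scale r (x + m) + n"
      by (auto simp: quotient_scale_def elt_set_plus_def set_plus_def)
    then have "y = scale r x + (scale r m + n)" "scale r m + n \<in> N"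
      using N by (auto simp: scale_right_distrib add.assoc intro: subspace_add subspace_scale)
    then show "y \<in> scale r x +o N" by (auto simp: elt_set_plus_def)
  next
    fix y assume "y \<in> scale r x +o N"
    then obtain n where n: "n \<in> N" "y = scale r x + n" by (auto simp: elt_set_plus_def)
    have "x \<in> x +o N" using subspace_0[OF N] by (force simp: elt_set_plus_def)
    then show "y \<in> quotient_scale scale N r (x +o N)"
      using n by (auto simp: quotient_scale_def set_plus_def)
  qed
qed

text \<open>
  A quasi-polynomial \<open>Q\<close> is given together with its coefficient functions, \<open>a i\<close> being the
  coefficient of \<open>n ^ i\<close>; only the \<open>a i\<close> with \<open>i \<le> u\<close> matter. The case \<open>u = -1\<close>,
  needed for modules of dimension \<open>0\<close>, is the zero function.
\<close>

definition quasi_polynomial ::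
  "int \<Rightarrow> (nat \<Rightarrow> int \<Rightarrow> complex) \<Rightarrow> (int \<Rightarrow> complex) \<Rightarrow> bool" where
  "quasi_polynomial u a Q \<longleftrightarrow> u \<ge> -1 \<and>
     (\<forall>n. Q n = (\<Sum>i | int i \<le> u. a i n * of_int n ^ i)) \<and>
     (\<forall>i. int i \<le> u \<longrightarrow> (\<exists>p>0. \<forall>n. a i (n + p) = a i n)) \<and>
     (u \<ge> 0 \<longrightarrow> (\<exists>n. a (nat u) n \<noteq> 0))"

definition qp_period :: "int \<Rightarrow> (nat \<Rightarrow> int \<Rightarrow> complex) \<Rightarrow> nat" where
  "qp_period u a = (LEAST p. p > 0 \<and> (\<forall>i n m. int i \<le> u \<longrightarrow> a i (n + m * int p) = a i n))"

definition qp_grade :: "int \<Rightarrow> (nat \<Rightarrow> int \<Rightarrow> complex) \<Rightarrow> int" where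
  "qp_grade u a = (LEAST \<delta>. \<delta> \<ge> -1 \<and> (\<forall>i. \<delta> < int i \<and> int i \<le> u \<longrightarrow> (\<exists>c. \<forall>n. a i n = c)))"

definition is_hilbert_quasi_polynomial ::
  "('k::field \<Rightarrow> 'r::comm_ring_1 \<Rightarrow> 'r) \<Rightarrow> ('r \<Rightarrow> 'm::ab_group_add \<Rightarrow> 'm) \<Rightarrow> (int \<Rightarrow> 'm set)
     \<Rightarrow> int \<Rightarrow> (nat \<Rightarrow> int \<Rightarrow> complex) \<Rightarrow> (int \<Rightarrow> complex) \<Rightarrow> bool" where
  "is_hilbert_quasi_polynomial kscale rscale M u a Q \<longleftrightarrow> quasi_polynomial u a Q \<and>
     (\<forall>\<^sub>F n in at_top. of_nat (hilbert_function kscale rscale M n) = Q n)"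

text \<open>
  Only generators of positive degree are taken. This matters just for \<open>p = 1\<close>: since
  \<open>gcd 0 1 = 1\<close>, the element \<open>1\<close> of degree \<open>0\<close> would otherwise make the ideal the whole
  ring and its quotients zero.
\<close>

definition coprime_degree_ideal :: "(nat \<Rightarrow> 'r::comm_ring_1 set) \<Rightarrow> nat \<Rightarrow> 'r set" where
  "coprime_degree_ideal R p = module.span (*) {x. \<exists>i>0. x \<in> R i \<and> gcd i p = 1}"

end

theory Submission
  imports Defs "HOL-Computational_Algebra.Fundamental_Theorem_Algebra"
begin

text \<open>
  The grade of the Hilbert quasi-polynomial is governed by the poles of the Hilbert series
  \<open>H(t) = \<Sum>n. H(M, n) t ^ n\<close> at roots of unity other than \<open>1\<close>. If \<open>\<delta> \<ge> 0\<close> is the grade, the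
  coefficient \<open>a \<delta>\<close> is not constant while all higher ones are, so there is a root of unity
  \<open>\<zeta> \<noteq> 1\<close> with \<open>\<zeta> ^ \<pi> = 1\<close> at which \<open>H\<close> has a pole of order greater than \<open>\<delta>\<close>
  (\<open>nonconstant_coefficient_gives_pole\<close>).

  On the other hand, the order of the pole at such a \<open>\<zeta>\<close> is at most the dimension of \<open>M / I M\<close>.
  By a filtration of \<open>M\<close> this reduces to \<open>R / P\<close> for homogeneous primes \<open>P\<close> that contain the
  annihilator of \<open>M\<close>. If some homogeneous \<open>x \<notin> P\<close> has degree \<open>e\<close> prime to \<open>\<pi>\<close>, then
  \<open>\<zeta> ^ e \<noteq> 1\<close>; the series of \<open>R / (P + x R)\<close> is \<open>1 - t ^ e\<close> times that of \<open>R / P\<close> and has the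
  same order at \<open>\<zeta>\<close>, so \<open>P\<close> may be enlarged at no cost until it contains \<open>I\<close>. From then on
  dividing by a homogeneous element of positive degree lowers the order by at most one and the
  dimension by at least one. This Noetherian induction is \<open>pole_order_quotient_le_chain_length\<close>, and the filtration of the module is
  in \<open>pole_order_hilbert_function_le_chain_length\<close>. The bound comes out in terms of chains of primes
  that contain \<open>I\<close> and the annihilator of \<open>M\<close>; these primes contain the annihilator of \<open>M / I M\<close>
  by \<open>prime_contains_annihilator_quotient\<close>.

  If the grade is \<open>-1\<close>, it only has to be seen that \<open>M / I M\<close> has a prime in its support, and
  the ideal of elements without component of degree \<open>0\<close> is one (\<open>irrelevant_ideal_chain\<close>).

  The induction rests on the Hilbert basis theorem (\<open>hilbert_basis_adjoin\<close>), which also shows that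
  the graded pieces are finite-dimensional (\<open>graded_piece_finite_dimensional\<close>). Poles are expressed
  algebraically, through the action of polynomials on sequences by shifts.
\<close>

section \<open>Sequences under the shift and pole orders of their generating series\<close>

text \<open>
  The polynomial variable acts on sequences as the backward shift. Up to eventual equality this
  is multiplication of the generating Laurent series \<open>\<Sum>n. f n * t ^ n\<close> by \<open>p\<close>.
\<close>

definition act :: "complex poly \<Rightarrow> (int \<Rightarrow> complex) \<Rightarrow> int \<Rightarrow> complex" where
  "act p f n = (\<Sum>i\<le>degree p. coeff p i * f (n - int i))"

lemma act_bound:
  assumes "degree p \<le> N"
  shows "act p f n = (\<Sum>i\<le>N. coeff p i * f (n - int i))"
  unfolding act_def using assms
  by (intro sum.mono_neutral_left) (auto simp: coeff_eq_0)

lemma act_0 [simp]: "act 0 f = (\<lambda>_. 0)"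
  by (simp add: act_def fun_eq_iff)

lemma act_pCons: "act (pCons c p) f = (\<lambda>n. c * f n + act p f (n - 1))"
proof
  fix n
  have "act (pCons c p) f n = (\<Sum>i\<le>Suc (degree p). coeff (pCons c p) i * f (n - int i))"
    by (rule act_bound) (simp add: degree_pCons_le)
  also have "\<dots> = c * f n + act p f (n - 1)"
    by (subst sum.atMost_Suc_shift) (simp add: act_def algebra_simps)
  finally show "act (pCons c p) f n = c * f n + act p f (n - 1)" .
qed

lemma act_1 [simp]: "act 1 f = f"
  by (simp add: one_pCons act_pCons)

lemma act_add: "act (p + q) f n = act p f n + act q f n"
proof -
  let ?N = "max (degree p) (degree q)"
  show ?thesis
    using act_bound[of "p + q" ?N f n] act_bound[of p ?N f n] act_bound[of q ?N f n]
    by (simp add: degree_add_le sum.distrib algebra_simps)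
qed

lemma act_smult: "act (smult c p) f n = c * act p f n"
  using act_bound[of "smult c p" "degree p" f n]
  by (simp add: act_def sum_distrib_left mult.assoc)

lemma act_mult: "act (p * q) f = act p (act q f)"
proof (induction p)
  case (pCons c p)
  show ?case
    by (simp add: fun_eq_iff act_add act_smult act_pCons pCons.IH)
qed simp

lemma act_minus: "act (- p) f n = - act p f n"
  using act_smult[of "-1" p f n] by simp

lemma act_diff: "act (p - q) f n = act p f n - act q f n"
  using act_add[of p "- q" f n] by (simp add: act_minus)

lemma act_fun_add: "act p (\<lambda>n. f n + g n) n = act p f n + act p g n"
  by (simp add: act_def sum.distrib algebra_simps)

lemma act_fun_mult: "act p (\<lambda>n. c * f n) n = c * act p f n"
  by (simp add: act_def sum_distrib_left mult.left_commute)

lemma act_shift: "act p (\<lambda>n. f (n - e)) n = act p f (n - e)"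
  by (simp add: act_def algebra_simps)

lemma act_zero_fun [simp]: "act p (\<lambda>n. 0) = (\<lambda>_. 0)"
  by (simp add: act_def fun_eq_iff)

lemma act_X_power: "act ([:0, 1:] ^ e) f n = f (n - int e)"
  by (induction e arbitrary: n) (auto simp: act_mult act_pCons algebra_simps)

text \<open>
  A sequence annihilated by \<open>t - \<zeta>\<close> is a geometric progression, so it is an eigenvector of the
  shift and hence of every polynomial in it.
\<close>

lemma act_eigen:
  assumes "act [:-\<zeta>, 1:] v = (\<lambda>_. 0)"
  shows "act p v n = poly p \<zeta> * v n"
proof (induction p arbitrary: n)
  case (pCons c p)
  have "v (n - 1) = \<zeta> * v n"
    using fun_cong[OF assms, of n] by (simp add: act_pCons)
  then show ?case
    by (simp add: act_pCons pCons.IH algebra_simps)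
qed simp

lemma eventually_shift:
  assumes "\<forall>\<^sub>F n in at_top. P (n :: int)"
  shows "\<forall>\<^sub>F n in at_top. P (n - e)"
proof -
  obtain N where "\<And>n. n \<ge> N \<Longrightarrow> P n" using assms by (auto simp: eventually_at_top_linorder)
  then show ?thesis unfolding eventually_at_top_linorder by (intro exI[of _ "N + e"]) auto
qed

lemma eventually_act_zero:
  assumes "\<forall>\<^sub>F n in at_top. f n = (0 :: complex)"
  shows "\<forall>\<^sub>F n in at_top. act p f n = 0"
proof (induction p)
  case (pCons c p)
  show ?case
    using assms eventually_shift[OF pCons.IH, of 1]
    by eventually_elim (simp add: act_pCons)
qed simp

lemma act_eventually_cong:
  assumes "\<forall>\<^sub>F n in at_top. f n = (g n :: complex)"
  shows "\<forall>\<^sub>F n in at_top. act p f n = act p g n"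
proof -
  have "\<forall>\<^sub>F n in at_top. act p (\<lambda>n. f n + (-1) * g n) n = 0"
    by (rule eventually_act_zero) (use assms in eventually_elim, simp)
  then show ?thesis
    by eventually_elim (simp only: act_fun_add act_fun_mult, simp)
qed

text \<open>
  The generating series of \<open>f\<close> has a pole of order at most \<open>k\<close> at \<open>\<zeta>\<close>: after multiplication by
  \<open>(t - \<zeta>) ^ k\<close> and by a polynomial \<open>g\<close> that clears the poles at other points, it is a Laurent
  polynomial.
\<close>

definition pole_order_le :: "complex \<Rightarrow> nat \<Rightarrow> (int \<Rightarrow> complex) \<Rightarrow> bool" where
  "pole_order_le \<zeta> k f \<longleftrightarrow>
     (\<exists>g. poly g \<zeta> \<noteq> 0 \<and> (\<forall>\<^sub>F n in at_top. act (g * [:-\<zeta>, 1:] ^ k) f n = 0))"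

lemma pole_order_le_mono:
  assumes "pole_order_le \<zeta> k f" "k \<le> l"
  shows "pole_order_le \<zeta> l f"
proof -
  obtain g where g: "poly g \<zeta> \<noteq> 0" "\<forall>\<^sub>F n in at_top. act (g * [:-\<zeta>, 1:] ^ k) f n = 0"
    using assms(1) by (auto simp: pole_order_le_def)
  have "g * [:-\<zeta>, 1:] ^ l = [:-\<zeta>, 1:] ^ (l - k) * (g * [:-\<zeta>, 1:] ^ k)"
    using assms(2) by (simp add: power_add[symmetric] mult.left_commute)
  then have "\<forall>\<^sub>F n in at_top. act (g * [:-\<zeta>, 1:] ^ l) f n = 0"
    using eventually_act_zero[OF g(2), of "[:-\<zeta>, 1:] ^ (l - k)"] by (simp only: act_mult)
  with g(1) show ?thesis by (auto simp: pole_order_le_def)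
qed

lemma pole_order_le_eventually_zero:
  assumes "\<forall>\<^sub>F n in at_top. f n = 0"
  shows "pole_order_le \<zeta> k f"
  unfolding pole_order_le_def by (rule exI[of _ 1]) (simp add: eventually_act_zero[OF assms])

lemma pole_order_le_cong:
  assumes "\<forall>\<^sub>F n in at_top. f n = g n" "pole_order_le \<zeta> k f"
  shows "pole_order_le \<zeta> k g"
proof -
  obtain p where p: "poly p \<zeta> \<noteq> 0" "\<forall>\<^sub>F n in at_top. act (p * [:-\<zeta>, 1:] ^ k) f n = 0"
    using assms(2) by (auto simp: pole_order_le_def)
  have "\<forall>\<^sub>F n in at_top. act (p * [:-\<zeta>, 1:] ^ k) g n = 0"
    using p(2) act_eventually_cong[OF assms(1), of "p * [:-\<zeta>, 1:] ^ k"] by eventually_elim simp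
  with p(1) show ?thesis by (auto simp: pole_order_le_def)
qed

lemma pole_order_le_add:
  assumes "pole_order_le \<zeta> k f" "pole_order_le \<zeta> k f'"
  shows "pole_order_le \<zeta> k (\<lambda>n. f n + f' n)"
proof -
  obtain g g' where g: "poly g \<zeta> \<noteq> 0" "\<forall>\<^sub>F n in at_top. act (g * [:-\<zeta>, 1:] ^ k) f n = 0"
    and g': "poly g' \<zeta> \<noteq> 0" "\<forall>\<^sub>F n in at_top. act (g' * [:-\<zeta>, 1:] ^ k) f' n = 0"
    using assms by (auto simp: pole_order_le_def)
  let ?p = "g' * g * [:-\<zeta>, 1:] ^ k"
  have "\<forall>\<^sub>F n in at_top. act ?p f n = 0"
    using eventually_act_zero[OF g(2), of g'] by (simp only: act_mult mult.assoc)
  moreover have "\<forall>\<^sub>F n in at_top. act ?p f' n = 0"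
    using eventually_act_zero[OF g'(2), of g]
    by (simp only: act_mult[symmetric] mult.assoc mult.left_commute)
  ultimately have "\<forall>\<^sub>F n in at_top. act ?p (\<lambda>n. f n + f' n) n = 0"
    by eventually_elim (simp add: act_fun_add)
  then show ?thesis
    unfolding pole_order_le_def by (intro exI[of _ "g' * g"]) (simp add: g g')
qed

lemma pole_order_le_shift:
  assumes "pole_order_le \<zeta> k f"
  shows "pole_order_le \<zeta> k (\<lambda>n. f (n - e))"
proof -
  obtain g where g: "poly g \<zeta> \<noteq> 0" "\<forall>\<^sub>F n in at_top. act (g * [:-\<zeta>, 1:] ^ k) f n = 0"
    using assms by (auto simp: pole_order_le_def)
  from eventually_shift[OF g(2), of e] g(1) show ?thesis
    unfolding pole_order_le_def act_shift by auto
qed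

lemma act_one_minus_X_power: "act (1 - [:0, 1:] ^ e) f n = f n - f (n - int e)"
  by (simp add: act_diff act_X_power)

text \<open>
  Taking the difference multiplies the series by \<open>1 - t ^ e\<close>, which is a unit near \<open>\<zeta>\<close> here
  and therefore leaves the order of the pole unchanged.
\<close>

lemma pole_order_le_difference:
  assumes "pole_order_le \<zeta> k (\<lambda>n. f n - f (n - int e))" "\<zeta> ^ e \<noteq> 1"
  shows "pole_order_le \<zeta> k f"
proof -
  let ?d = "1 - [:0, 1:] ^ e :: complex poly"
  obtain g where g: "poly g \<zeta> \<noteq> 0"
    "\<forall>\<^sub>F n in at_top. act (g * [:-\<zeta>, 1:] ^ k) (act ?d f) n = 0"
    using assms(1) by (auto simp: pole_order_le_def act_one_minus_X_power[abs_def])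
  have "poly (g * ?d) \<zeta> \<noteq> 0" using g(1) assms(2) by simp
  moreover have "g * ?d * [:-\<zeta>, 1:] ^ k = g * [:-\<zeta>, 1:] ^ k * ?d" by (simp only: mult_ac)
  ultimately show ?thesis using g(2)
    unfolding pole_order_le_def by (intro exI[of _ "g * ?d"]) (simp only: act_mult, simp)
qed

text \<open>
  For arbitrary \<open>e > 0\<close> the factor \<open>1 - t ^ e\<close> has at most a simple zero at \<open>\<zeta>\<close>, because its
  derivative vanishes only at \<open>0\<close>. So at most one order is lost.
\<close>

lemma pole_order_le_difference_Suc:
  assumes "pole_order_le \<zeta> k (\<lambda>n. f n - f (n - int e))" "e > 0"
  shows "pole_order_le \<zeta> (Suc k) f"
proof (cases "\<zeta> ^ e = 1")
  case False
  then show ?thesis using pole_order_le_difference[OF assms(1)] pole_order_le_mono by (metis le_SucI order_refl)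
next
  case True
  let ?d = "1 - [:0, 1:] ^ e :: complex poly"
  obtain g where g: "poly g \<zeta> \<noteq> 0"
    "\<forall>\<^sub>F n in at_top. act (g * [:-\<zeta>, 1:] ^ k) (act ?d f) n = 0"
    using assms(1) by (auto simp: pole_order_le_def act_one_minus_X_power[abs_def])
  have "[:-\<zeta>, 1:] dvd ?d" using True by (simp add: poly_eq_0_iff_dvd[symmetric])
  then obtain q where q: "?d = [:-\<zeta>, 1:] * q" by (rule dvdE)
  have "\<zeta> \<noteq> 0" using True assms(2) by (auto simp: power_0_left)
  have "poly (pderiv ?d) \<zeta> = poly q \<zeta>"
    unfolding q by (simp add: pderiv_mult pderiv_pCons del: mult_pCons_left)
  moreover have "poly (pderiv ?d) \<zeta> = - of_nat e * \<zeta> ^ (e - 1)"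
    using assms(2) by (simp add: pderiv_diff pderiv_power pderiv_pCons)
  ultimately have "poly q \<zeta> \<noteq> 0" using \<open>\<zeta> \<noteq> 0\<close> assms(2) by auto
  then have "poly (g * q) \<zeta> \<noteq> 0" using g(1) by simp
  moreover have "g * q * [:-\<zeta>, 1:] ^ Suc k = g * [:-\<zeta>, 1:] ^ k * ?d"
    unfolding q by (simp only: mult_ac power_Suc)
  ultimately show ?thesis using g(2)
    unfolding pole_order_le_def by (intro exI[of _ "g * q"]) (simp only: act_mult, simp)
qed

text \<open>
  Linear factors are split off from \<open>p\<close> one at a time. The last sequence before the product
  becomes zero is an eigenvector. It takes the place of a Fourier component of \<open>f\<close>.
\<close>

lemma exists_eigenvector:
  assumes "act p f = (\<lambda>_. 0)" "p \<noteq> 0" "f \<noteq> (\<lambda>_. 0)"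
  shows "\<exists>\<zeta> q. poly p \<zeta> = 0 \<and> act q f \<noteq> (\<lambda>_. 0) \<and> act [:-\<zeta>, 1:] (act q f) = (\<lambda>_. 0)"
  using assms
proof (induction "degree p" arbitrary: p rule: less_induct)
  case less
  show ?case
  proof (cases "degree p = 0")
    case True
    then obtain c where p: "p = [:c:]" by (auto elim: degree_eq_zeroE)
    then have "c \<noteq> 0" using less.prems by auto
    then have "f = (\<lambda>_. 0)" using less.prems(1) by (auto simp: p act_pCons fun_eq_iff)
    then show ?thesis using less.prems by simp
  next
    case False
    then have "\<not> constant (poly p)" by (simp add: constant_degree)
    then obtain \<zeta> where z: "poly p \<zeta> = 0" using fundamental_theorem_of_algebra by blast
    then obtain q where q: "p = [:-\<zeta>, 1:] * q" by (auto simp: poly_eq_0_iff_dvd)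
    have "q \<noteq> 0" using less.prems(2) q by auto
    then have dq: "degree q < degree p" unfolding q by (subst degree_mult_eq) auto
    show ?thesis
    proof (cases "act q f = (\<lambda>_. 0)")
      case True
      from less.hyps[OF dq True \<open>q \<noteq> 0\<close> less.prems(3)] obtain \<xi> r where
        "poly q \<xi> = 0" "act r f \<noteq> (\<lambda>_. 0)" "act [:-\<xi>, 1:] (act r f) = (\<lambda>_. 0)"
        by blast
      moreover have "poly p \<xi> = 0" using \<open>poly q \<xi> = 0\<close> by (simp add: q)
      ultimately show ?thesis by blast
    next
      case False
      moreover have "act [:-\<zeta>, 1:] (act q f) = (\<lambda>_. 0)"
        using less.prems(1) by (simp only: q act_mult)
      ultimately show ?thesis using z by blast
    qed
  qed
qed

text \<open>
  Differences with step \<open>p\<close> treat coefficients of period \<open>p\<close> as constants, so the \<open>k\<close>-th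
  difference isolates the leading coefficient as it does for ordinary polynomials. The lemma is
  used with the common period and, for constant coefficients, with \<open>p = 1\<close>.
\<close>

lemma finite_difference_quasi_polynomial:
  fixes b :: "nat \<Rightarrow> int \<Rightarrow> complex"
  assumes per: "\<And>i n. i \<le> k \<Longrightarrow> b i (n - int p) = b i n"
  shows "act ((1 - [:0, 1:] ^ p) ^ k) (\<lambda>n. \<Sum>i\<le>k. b i n * of_int n ^ i) =
         (\<lambda>n. fact k * of_nat p ^ k * b k n)"
  using per
proof (induction k arbitrary: b)
  case (Suc k)
  \<comment> \<open>the coefficients of the first difference, from the binomial expansion of \<open>(n - p) ^ i\<close>\<close>
  define b' where "b' j n = - (\<Sum>i\<in>{j<..Suc k}. b i n * of_nat (i choose j) * (- of_nat p) ^ (i - j))"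
    for j n
  have step: "act (1 - [:0, 1:] ^ p) (\<lambda>n. \<Sum>i\<le>Suc k. b i n * of_int n ^ i) n
      = (\<Sum>j\<le>k. b' j n * of_int n ^ j)" for n
  proof -
    let ?t = "\<lambda>i j. b i n * of_nat (i choose j) * (- of_nat p) ^ (i - j) * of_int n ^ j"
    have binom: "(of_int n :: complex) ^ i - of_int (n - int p) ^ i
        = - (\<Sum>j<i. of_nat (i choose j) * (- of_nat p) ^ (i - j) * of_int n ^ j)" for i
    proof -
      have "of_int (n - int p) ^ i = (of_int n + (- of_nat p :: complex)) ^ i" by simp
      also have "\<dots> = (\<Sum>j\<le>i. of_nat (i choose j) * of_int n ^ j * (- of_nat p) ^ (i - j))"
        by (rule binomial_ring)
      also have "\<dots> = of_int n ^ i + (\<Sum>j<i. of_nat (i choose j) * of_int n ^ j * (- of_nat p) ^ (i - j))"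
        by (simp add: lessThan_Suc_atMost[symmetric])
      finally show ?thesis by (simp add: mult_ac)
    qed
    have "act (1 - [:0, 1:] ^ p) (\<lambda>n. \<Sum>i\<le>Suc k. b i n * of_int n ^ i) n
        = (\<Sum>i\<le>Suc k. b i n * of_int n ^ i - b i (n - int p) * of_int (n - int p) ^ i)"
      by (simp only: act_one_minus_X_power sum_subtractf)
    also have "\<dots> = (\<Sum>i\<le>Suc k. b i n * (of_int n ^ i - of_int (n - int p) ^ i))"
      by (intro sum.cong refl) (simp only: Suc.prems atMost_iff right_diff_distrib)
    also have "\<dots> = - (\<Sum>i\<le>Suc k. \<Sum>j<i. ?t i j)"
      by (simp only: binom sum_negf[symmetric] mult_minus_right sum_distrib_left mult.assoc)
    also have "(\<Sum>i\<le>Suc k. \<Sum>j<i. ?t i j) = (\<Sum>j\<le>k. \<Sum>i\<in>{j<..Suc k}. ?t i j)"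
      by (subst sum.Sigma, simp, simp, subst sum.Sigma, simp, simp)
         (rule sum.reindex_bij_witness[where i = prod.swap and j = prod.swap], auto)
    also have "- \<dots> = (\<Sum>j\<le>k. b' j n * of_int n ^ j)"
      by (simp only: b'_def sum_distrib_right sum_negf[symmetric] mult_minus_left)
    finally show ?thesis .
  qed
  have top: "b' k n = of_nat (Suc k) * of_nat p * b (Suc k) n" for n
  proof -
    have "{k<..Suc k} = {Suc k}" by auto
    then show ?thesis by (simp add: b'_def)
  qed
  have "act ((1 - [:0, 1:] ^ p) ^ Suc k) (\<lambda>n. \<Sum>i\<le>Suc k. b i n * of_int n ^ i)
      = act ((1 - [:0, 1:] ^ p) ^ k) (\<lambda>n. \<Sum>j\<le>k. b' j n * of_int n ^ j)"
    unfolding power_Suc2 act_mult by (simp only: step[abs_def])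
  also have "\<dots> = (\<lambda>n. fact k * of_nat p ^ k * b' k n)"
    by (rule Suc.IH) (simp add: b'_def Suc.prems)
  also have "\<dots> = (\<lambda>n. fact (Suc k) * of_nat p ^ Suc k * b (Suc k) n)"
    by (simp add: top fun_eq_iff fact_Suc mult_ac)
  finally show ?case .
qed (simp add: fun_eq_iff)

text \<open>
  This is where the grade enters. The coefficients above \<open>\<delta>\<close> are constant and contribute a pole
  at \<open>1\<close> only, which a power of \<open>1 - t\<close> removes. The remaining sum has degree \<open>\<delta>\<close>, and
  \<open>(1 - t ^ p) ^ \<delta>\<close> turns it into a multiple of \<open>a \<delta>\<close>. As \<open>a \<delta>\<close> is periodic and not constant,
  it has an eigencomponent for some \<open>p\<close>-th root of unity \<open>\<zeta> \<noteq> 1\<close>. If the pole at \<open>\<zeta>\<close> had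
  order at most \<open>\<delta>\<close>, then some polynomial not vanishing at \<open>\<zeta>\<close> would make this eigencomponent
  eventually zero, which is impossible for a nonzero geometric progression.
\<close>

lemma nonconstant_coefficient_gives_pole:
  fixes a :: "nat \<Rightarrow> int \<Rightarrow> complex"
  assumes p: "p > 0"
    and per: "\<And>i n. i \<le> u \<Longrightarrow> a i (n - int p) = a i n"
    and \<delta>: "\<delta> \<le> u"
    and const: "\<And>i n m. \<delta> < i \<Longrightarrow> i \<le> u \<Longrightarrow> a i n = a i m"
    and nonconst: "\<not> (\<exists>c. \<forall>n. a \<delta> n = c)"
  shows "\<exists>\<zeta>. \<zeta> ^ p = 1 \<and> \<zeta> \<noteq> 1 \<and> \<not> pole_order_le \<zeta> \<delta> (\<lambda>n. \<Sum>i\<le>u. a i n * of_int n ^ i)"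
proof -
  define X where "X = ([:0, 1:] :: complex poly)"
  define Q where "Q = (\<lambda>n. \<Sum>i\<le>u. a i n * of_int n ^ i)"
  define Q1 where "Q1 = (\<lambda>n. \<Sum>i\<le>u. (if \<delta> < i then a i n else 0) * (of_int n) ^ i)"
  define Q2 where "Q2 = (\<lambda>n. \<Sum>i\<le>\<delta>. a i n * (of_int n) ^ i)"
  define G where "G = (\<Sum>i<p. X ^ i)"
  have XG: "1 - X ^ p = (1 - X) * G" by (simp add: G_def one_diff_power_eq)
  have Q_split: "Q n = Q1 n + Q2 n" for n
  proof -
    have "Q2 n = (\<Sum>i\<le>u. (if \<delta> < i then 0 else a i n) * of_int n ^ i)"
      unfolding Q2_def using \<delta> by (intro sum.mono_neutral_cong_left) auto
    then show ?thesis
      unfolding Q_def Q1_def by (simp add: sum.distrib[symmetric] if_distrib algebra_simps cong: if_cong)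
        (intro sum.cong, auto)
  qed
  have Q1: "act ((1 - X) ^ Suc u) Q1 = (\<lambda>_. 0)"
  proof -
    have "act ((1 - [:0, 1:] ^ 1) ^ u) Q1
        = (\<lambda>n. fact u * of_nat 1 ^ u * (if \<delta> < u then a u n else 0))"
      unfolding Q1_def by (rule finite_difference_quasi_polynomial) (use const in auto)
    then have "act ((1 - X) ^ Suc u) Q1 = act (1 - X ^ 1) (\<lambda>n. fact u * (if \<delta> < u then a u n else 0))"
      by (simp add: X_def act_mult)
    also have "\<dots> = (\<lambda>n. 0)"
      unfolding X_def act_one_minus_X_power using const[of u] by auto
    finally show ?thesis .
  qed
  have Q2: "act ((1 - X ^ p) ^ \<delta>) Q2 = (\<lambda>n. fact \<delta> * of_nat p ^ \<delta> * a \<delta> n)"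
    unfolding Q2_def X_def by (rule finite_difference_quasi_polynomial) (use \<delta> per in auto)
  \<comment> \<open>subtracting the shift removes the constant part of \<open>a \<delta>\<close>, so that \<open>\<zeta> = 1\<close> cannot occur below\<close>
  define f where "f = act (1 - X) (a \<delta>)"
  have "f \<noteq> (\<lambda>_. 0)"
  proof
    assume "f = (\<lambda>_. 0)"
    then have *: "a \<delta> (n - 1) = a \<delta> n" for n
      unfolding f_def X_def using act_one_minus_X_power[of 1 "a \<delta>" n] by simp
    have "a \<delta> n = a \<delta> 0" for n
    proof (induction n rule: int_induct[where k = 0])
      case (step1 i) then show ?case using *[of "i + 1"] by simp
    next
      case (step2 i) then show ?case using *[of i] by simp
    qed simp
    then show False using nonconst by blast
  qed
  moreover have "act G f = (\<lambda>_. 0)"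
  proof -
    have "act G f = act (1 - X ^ p) (a \<delta>)"
      unfolding f_def XG by (simp only: act_mult[symmetric] mult.commute)
    also have "\<dots> = (\<lambda>_. 0)"
      unfolding X_def using per[OF \<delta>] by (simp add: fun_eq_iff act_one_minus_X_power)
    finally show ?thesis .
  qed
  moreover have G1: "poly G 1 \<noteq> 0" using p by (simp add: G_def X_def poly_sum)
  then have "G \<noteq> 0" by auto
  ultimately obtain \<zeta> q where z: "poly G \<zeta> = 0" and v0: "act q f \<noteq> (\<lambda>_. 0)"
    and veig: "act [:-\<zeta>, 1:] (act q f) = (\<lambda>_. 0)"
    using exists_eigenvector[of G f] by blast
  define v where "v = act q f"
  have z1: "\<zeta> \<noteq> 1" using z G1 by auto
  have "poly (1 - X ^ p) \<zeta> = 0" unfolding XG using z by simp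
  then have zp: "\<zeta> ^ p = 1" by (simp add: X_def)
  have "[:-\<zeta>, 1:] dvd 1 - X ^ p" using zp by (simp add: poly_eq_0_iff_dvd[symmetric] X_def)
  then obtain C where C: "1 - X ^ p = [:-\<zeta>, 1:] * C" by (rule dvdE)
  have "\<not> pole_order_le \<zeta> \<delta> Q"
  proof
    assume "pole_order_le \<zeta> \<delta> Q"
    then obtain g where g: "poly g \<zeta> \<noteq> 0" "\<forall>\<^sub>F n in at_top. act (g * [:-\<zeta>, 1:] ^ \<delta>) Q n = 0"
      by (auto simp: pole_order_le_def)
    define h where "h = (1 - X) ^ Suc u"
    define c where "c = (fact \<delta> * of_nat p ^ \<delta> :: complex)"
    \<comment> \<open>\<open>?w\<close> completes \<open>(t - \<zeta>) ^ \<delta>\<close> to \<open>(1 - t ^ p) ^ \<delta>\<close>, kills the polynomial part and projects to \<open>v\<close>\<close>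
    let ?w = "q * (1 - X) * h * C ^ \<delta>"
    have "?w * (g * [:-\<zeta>, 1:] ^ \<delta>) = q * (1 - X) * g * h * (1 - X ^ p) ^ \<delta>"
      unfolding C power_mult_distrib by (simp only: mult_ac)
    then have ev: "\<forall>\<^sub>F n in at_top. act (q * (1 - X) * g * h * (1 - X ^ p) ^ \<delta>) Q n = 0"
      using eventually_act_zero[OF g(2), of ?w] by (simp only: act_mult[symmetric])
    have poly_part: "act (q * (1 - X) * g * h * (1 - X ^ p) ^ \<delta>) Q1 n = 0" for n
    proof -
      have "q * (1 - X) * g * h * (1 - X ^ p) ^ \<delta> = q * (1 - X) * g * (1 - X ^ p) ^ \<delta> * h"
        by (simp only: mult_ac)
      moreover have "act h Q1 = (\<lambda>_. 0)" unfolding h_def by (rule Q1)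
      ultimately show ?thesis by (simp only: act_mult[of _ h] act_zero_fun)
    qed
    have periodic_part:
      "act (q * (1 - X) * g * h * (1 - X ^ p) ^ \<delta>) Q2 n = c * act (g * h) v n" for n
    proof -
      have "act (q * (1 - X) * g * h) (\<lambda>n. c * a \<delta> n) n = c * act (q * (1 - X) * g * h) (a \<delta>) n"
        by (rule act_fun_mult)
      also have "act (q * (1 - X) * g * h) (a \<delta>) = act (g * h) v"
        unfolding v_def f_def act_mult[symmetric] by (simp only: mult_ac)
      finally show ?thesis unfolding act_mult[of _ "(1 - X ^ p) ^ \<delta>"] Q2 c_def .
    qed
    have *: "act (q * (1 - X) * g * h * (1 - X ^ p) ^ \<delta>) Q n
        = c * (poly (g * h) \<zeta> * v n)" for n
      unfolding Q_split[abs_def] act_fun_add poly_part periodic_part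
      using act_eigen[OF veig[folded v_def], of "g * h"] by simp
    have nz: "poly (g * h) \<zeta> \<noteq> 0" "c \<noteq> 0" using g(1) z1 p by (auto simp: h_def X_def c_def)
    have "\<forall>\<^sub>F n in at_top. v n = 0"
      using ev unfolding * by eventually_elim (use nz in auto)
    then obtain N where N: "\<And>n. n \<ge> N \<Longrightarrow> v n = 0" by (auto simp: eventually_at_top_linorder)
    have shift: "v (n - 1) = \<zeta> * v n" for n
      using fun_cong[OF veig, of n] by (simp add: act_pCons v_def)
    have "v n = 0" for n
    proof (cases "n \<le> N")
      case True
      then show ?thesis
      proof (induction n rule: int_le_induct)
        case (step i) then show ?case using shift by simp
      qed (simp add: N)
    qed (simp add: N)
    then show False using v0 by (auto simp: v_def)
  qed
  with zp z1 show ?thesis unfolding Q_def by blast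
qed

section \<open>Noetherian subrings and the Hilbert basis theorem\<close>

definition subring :: "'r::comm_ring_1 set \<Rightarrow> bool" where
  "subring S \<longleftrightarrow> 1 \<in> S \<and> (\<forall>x\<in>S. \<forall>y\<in>S. x - y \<in> S \<and> x * y \<in> S)"

text \<open>
  With \<open>J \<subseteq> S\<close> these are the ideals of \<open>S\<close>; stating the notion for subsets of one ambient ring
  allows an induction in which the subring grows.
\<close>

definition submodule_over :: "'r::comm_ring_1 set \<Rightarrow> 'r set \<Rightarrow> bool" where
  "submodule_over S J \<longleftrightarrow>
     0 \<in> J \<and> (\<forall>x\<in>J. \<forall>y\<in>J. x - y \<in> J) \<and> (\<forall>s\<in>S. \<forall>x\<in>J. s * x \<in> J)"

definition noetherian_subring :: "'r::comm_ring_1 set \<Rightarrow> bool" where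
  "noetherian_subring S \<longleftrightarrow>
     (\<forall>J :: nat \<Rightarrow> 'r set. (\<forall>n. J n \<subseteq> S \<and> submodule_over S (J n)) \<and> incseq J
        \<longrightarrow> (\<exists>N. \<forall>n\<ge>N. J n = J N))"

lemma subring_closed:
  assumes "subring S"
  shows "0 \<in> S" "1 \<in> S" "x \<in> S \<Longrightarrow> y \<in> S \<Longrightarrow> x - y \<in> S" "x \<in> S \<Longrightarrow> y \<in> S \<Longrightarrow> x * y \<in> S"
    "x \<in> S \<Longrightarrow> y \<in> S \<Longrightarrow> x + y \<in> S"
proof -
  show "1 \<in> S" and *: "\<And>x y. x \<in> S \<Longrightarrow> y \<in> S \<Longrightarrow> x - y \<in> S"
    and "x \<in> S \<Longrightarrow> y \<in> S \<Longrightarrow> x * y \<in> S"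
    using assms by (auto simp: subring_def)
  show 0: "0 \<in> S" using *[OF \<open>1 \<in> S\<close> \<open>1 \<in> S\<close>] by simp
  show "x + y \<in> S" if "x \<in> S" "y \<in> S"
    using *[OF that(1) *[OF 0 that(2)]] by simp
qed

lemma submodule_overD:
  assumes "submodule_over S J"
  shows "0 \<in> J" "x \<in> J \<Longrightarrow> y \<in> J \<Longrightarrow> x - y \<in> J" "s \<in> S \<Longrightarrow> x \<in> J \<Longrightarrow> s * x \<in> J"
    "x \<in> J \<Longrightarrow> y \<in> J \<Longrightarrow> x + y \<in> J"
proof -
  show 0: "0 \<in> J" and *: "\<And>x y. x \<in> J \<Longrightarrow> y \<in> J \<Longrightarrow> x - y \<in> J"
    and "s \<in> S \<Longrightarrow> x \<in> J \<Longrightarrow> s * x \<in> J"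
    using assms by (auto simp: submodule_over_def)
  show "x + y \<in> J" if "x \<in> J" "y \<in> J"
    using *[OF that(1) *[OF 0 that(2)]] by simp
qed

text \<open>
  The values at \<open>x\<close> of the polynomials of degree below \<open>k\<close> with coefficients in \<open>S\<close>. The basis
  theorem is proved for these values directly, since \<open>x\<close> may be algebraic over \<open>S\<close>.
\<close>

primrec poly_values :: "'r::comm_ring_1 set \<Rightarrow> 'r \<Rightarrow> nat \<Rightarrow> 'r set" where
  "poly_values S x 0 = {0}"
| "poly_values S x (Suc k) = {c * x ^ k + p | c p. c \<in> S \<and> p \<in> poly_values S x k}"

definition adjoin :: "'r::comm_ring_1 set \<Rightarrow> 'r \<Rightarrow> 'r set" where
  "adjoin S x = (\<Union>k. poly_values S x k)"

lemma poly_values_SucI: "c \<in> S \<Longrightarrow> p \<in> poly_values S x k \<Longrightarrow> c * x ^ k + p \<in> poly_values S x (Suc k)"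
  by auto

lemma poly_values_mono:
  assumes "subring S" "k \<le> l"
  shows "poly_values S x k \<subseteq> poly_values S x l"
  using assms(2)
proof (induction l rule: dec_induct)
  case (step l)
  have "poly_values S x l \<subseteq> poly_values S x (Suc l)"
    using subring_closed(1)[OF assms(1)] by (force intro: exI[of _ 0])
  with step show ?case by blast
qed simp

lemma poly_values_diff:
  assumes "subring S" "p \<in> poly_values S x k" "q \<in> poly_values S x k"
  shows "p - q \<in> poly_values S x k"
  using assms(2,3)
proof (induction k arbitrary: p q)
  case (Suc k)
  then obtain c p' d q' where p: "c \<in> S" "p' \<in> poly_values S x k" "p = c * x ^ k + p'"
    and q: "d \<in> S" "q' \<in> poly_values S x k" "q = d * x ^ k + q'" by auto
  have "p - q = (c - d) * x ^ k + (p' - q')" by (simp add: p(3) q(3) algebra_simps)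
  then show ?case
    using poly_values_SucI[OF subring_closed(3)[OF assms(1) p(1) q(1)] Suc.IH[OF p(2) q(2)]] by metis
qed simp

lemma poly_values_smult:
  assumes "subring S" "s \<in> S" "p \<in> poly_values S x k"
  shows "s * p \<in> poly_values S x k"
  using assms(3)
proof (induction k arbitrary: p)
  case (Suc k)
  then obtain c p' where p: "c \<in> S" "p' \<in> poly_values S x k" "p = c * x ^ k + p'" by auto
  have "s * p = (s * c) * x ^ k + s * p'" by (simp add: p(3) algebra_simps)
  then show ?case
    using poly_values_SucI[OF subring_closed(4)[OF assms(1,2) p(1)] Suc.IH[OF p(2)]] by metis
qed simp

lemma poly_values_mult_x:
  assumes "subring S" "p \<in> poly_values S x k"
  shows "x * p \<in> poly_values S x (Suc k)"
  using assms(2)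
proof (induction k arbitrary: p)
  case 0
  then show ?case using subring_closed(1)[OF assms(1)] by auto
next
  case (Suc k)
  then obtain c p' where c: "c \<in> S" "p' \<in> poly_values S x k" "p = c * x ^ k + p'" by auto
  then have "x * p = c * x ^ Suc k + x * p'" by (simp add: algebra_simps)
  then show ?case using poly_values_SucI[OF c(1) Suc.IH[OF c(2)]] by metis
qed

lemma adjoin_diff:
  assumes "subring S" "p \<in> adjoin S x" "q \<in> adjoin S x"
  shows "p - q \<in> adjoin S x"
proof -
  obtain k l where "p \<in> poly_values S x k" "q \<in> poly_values S x l"
    using assms by (auto simp: adjoin_def)
  then have "p \<in> poly_values S x (max k l)" "q \<in> poly_values S x (max k l)"
    using poly_values_mono[OF assms(1), of k "max k l" x]
      poly_values_mono[OF assms(1), of l "max k l" x] by auto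
  then show ?thesis using poly_values_diff[OF assms(1)] unfolding adjoin_def by blast
qed

lemma base_subset_adjoin: "S \<subseteq> adjoin S x"
proof
  fix s assume "s \<in> S"
  then have "s \<in> poly_values S x (Suc 0)" by auto
  then show "s \<in> adjoin S x" unfolding adjoin_def by blast
qed

lemma subring_adjoin:
  assumes S: "subring S"
  shows "subring (adjoin S x)"
proof -
  have diff: "p - q \<in> adjoin S x" if "p \<in> adjoin S x" "q \<in> adjoin S x" for p q
    using adjoin_diff[OF S that] .
  have x_mult: "x ^ k * q \<in> adjoin S x" if "q \<in> adjoin S x" for k q
  proof (induction k)
    case (Suc k)
    then obtain l where "x ^ k * q \<in> poly_values S x l" by (auto simp: adjoin_def)
    from poly_values_mult_x[OF S this] show ?case
      unfolding adjoin_def by (auto simp only: power_Suc mult.assoc)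
  qed (use that in simp)
  have s_mult: "s * q \<in> adjoin S x" if "s \<in> S" "q \<in> adjoin S x" for s q
    using that poly_values_smult[OF S] unfolding adjoin_def by blast
  have zero: "0 \<in> adjoin S x" using subring_closed(1)[OF S] base_subset_adjoin[of S x] by blast
  have mult: "p * q \<in> adjoin S x" if "p \<in> poly_values S x k" and q: "q \<in> adjoin S x" for p q k
    using that(1)
  proof (induction k arbitrary: p)
    case (Suc k)
    then obtain c p' where c: "c \<in> S" "p' \<in> poly_values S x k" "p = c * x ^ k + p'" by auto
    then have "p * q = c * (x ^ k * q) - (0 - p' * q)" by (simp add: algebra_simps)
    then show ?case using diff[OF s_mult[OF c(1) x_mult[OF q]] diff[OF zero Suc.IH[OF c(2)]]] by metis
  qed (simp add: zero)
  have "p * q \<in> adjoin S x" if "p \<in> adjoin S x" "q \<in> adjoin S x" for p q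
    using that(1) mult[OF _ that(2)] by (auto simp: adjoin_def[of S x])
  then show ?thesis
    using diff subring_closed(2)[OF S] base_subset_adjoin[of S x] unfolding subring_def by blast
qed

lemma element_in_adjoin:
  assumes "subring S"
  shows "x \<in> adjoin S x"
proof -
  have "x * 1 \<in> poly_values S x (Suc (Suc 0))"
    by (rule poly_values_mult_x[OF assms]) (use subring_closed[OF assms] in auto)
  then show ?thesis unfolding adjoin_def mult_1_right by blast
qed

text \<open>
  Coefficients of \<open>x ^ k\<close> in expressions of formal degree at most \<open>k\<close> for elements of \<open>J\<close>. As
  expressions are not unique, one element may contribute several coefficients.
\<close>

definition leading_coeffs :: "'r::comm_ring_1 set \<Rightarrow> 'r \<Rightarrow> 'r set \<Rightarrow> nat \<Rightarrow> 'r set" where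
  "leading_coeffs S x J k = {s \<in> S. \<exists>p\<in>poly_values S x k. s * x ^ k + p \<in> J}"

text \<open>
  The classical argument with leading coefficients. The ideals \<open>L n k\<close> of leading coefficients of
  degree \<open>k\<close> in \<open>J n\<close> increase in both indices. The diagonal becomes stationary at some \<open>N\<close>,
  which settles all \<open>k \<ge> N\<close> at once, and the finitely many chains with \<open>k < N\<close> become stationary
  as well. Equal leading coefficients in all degrees force equal ideals, by subtracting an element
  with the same leading coefficient and induction on the degree.
\<close>

lemma hilbert_basis_adjoin:
  assumes S: "subring S" and noeth: "noetherian_subring S"
  shows "noetherian_subring (adjoin S x)"
  unfolding noetherian_subring_def
proof (intro allI impI)
  fix J :: "nat \<Rightarrow> 'a set"
  assume "(\<forall>n. J n \<subseteq> adjoin S x \<and> submodule_over (adjoin S x) (J n)) \<and> incseq J"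
  then have J_sub: "J n \<subseteq> adjoin S x" and J: "submodule_over (adjoin S x) (J n)"
    and "incseq J" for n by auto
  then have J_mono: "n \<le> m \<Longrightarrow> J n \<subseteq> J m" for n m by (auto simp: incseq_def)
  have JS: "s * y \<in> J n" if "s \<in> S" "y \<in> J n" for s y n
    using submodule_overD(3)[OF J] that base_subset_adjoin[of S x] by blast
  define L where "L n k = leading_coeffs S x (J n) k" for n k
  have L_mono1: "L n k \<subseteq> L m k" if "n \<le> m" for n m k
    using J_mono[OF that] by (auto simp: L_def leading_coeffs_def)
  have L_step: "L n k \<subseteq> L n (Suc k)" for n k
  proof
    fix s assume "s \<in> L n k"
    then obtain p where p: "s \<in> S" "p \<in> poly_values S x k" "s * x ^ k + p \<in> J n"
      by (auto simp: L_def leading_coeffs_def)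
    have "x * (s * x ^ k + p) \<in> J n"
      using submodule_overD(3)[OF J element_in_adjoin[OF S]] p(3) .
    then have "s * x ^ Suc k + x * p \<in> J n" by (simp add: algebra_simps)
    then show "s \<in> L n (Suc k)"
      using p(1) poly_values_mult_x[OF S p(2)] unfolding L_def leading_coeffs_def by blast
  qed
  have L_mono2: "L n k \<subseteq> L n l" if "k \<le> l" for n k l
    using that by (induction l rule: dec_induct) (use L_step in auto)
  have L_sub: "submodule_over S (L n k)" for n k
    unfolding submodule_over_def
  proof (intro conjI ballI)
    have "0 \<in> poly_values S x k" using poly_values_mono[OF S, of 0 k x] by simp
    then show "0 \<in> L n k"
      using subring_closed(1)[OF S] submodule_overD(1)[OF J, of n]
      by (auto simp: L_def leading_coeffs_def intro!: bexI[of _ 0])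
  next
    fix s t assume "s \<in> L n k" "t \<in> L n k"
    then obtain p q where p: "s \<in> S" "p \<in> poly_values S x k" "s * x ^ k + p \<in> J n"
      and q: "t \<in> S" "q \<in> poly_values S x k" "t * x ^ k + q \<in> J n"
      by (auto simp: L_def leading_coeffs_def)
    have "(s - t) * x ^ k + (p - q) \<in> J n"
      using submodule_overD(2)[OF J p(3) q(3)] by (simp add: algebra_simps)
    then show "s - t \<in> L n k"
      using poly_values_diff[OF S p(2) q(2)] subring_closed(3)[OF S p(1) q(1)]
      by (auto simp: L_def leading_coeffs_def)
  next
    fix r s assume r: "r \<in> S" and "s \<in> L n k"
    then obtain p where p: "s \<in> S" "p \<in> poly_values S x k" "s * x ^ k + p \<in> J n"
      by (auto simp: L_def leading_coeffs_def)
    have "r * s * x ^ k + r * p \<in> J n" using JS[OF r p(3)] by (simp add: algebra_simps)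
    then show "r * s \<in> L n k"
      using poly_values_smult[OF S r p(2)] subring_closed(4)[OF S r p(1)]
      by (auto simp: L_def leading_coeffs_def)
  qed
  have L_S: "L n k \<subseteq> S" for n k by (auto simp: L_def leading_coeffs_def)
  have stable: "\<exists>N. \<forall>n\<ge>N. F n = F N"
    if "\<And>n. F n \<subseteq> S" "\<And>n. submodule_over S (F n)" "incseq F" for F
    using noeth that unfolding noetherian_subring_def by blast
  have "incseq (\<lambda>n. L n n)"
    unfolding incseq_def using L_mono1 L_mono2 by (meson subset_trans)
  then obtain N where N: "\<And>n. n \<ge> N \<Longrightarrow> L n n = L N N"
    using stable[of "\<lambda>n. L n n"] L_S L_sub by blast
  have "\<exists>m. \<forall>n\<ge>m. L n k = L m k" for k
    by (rule stable[of "\<lambda>n. L n k"]) (use L_S L_sub L_mono1 in \<open>auto simp: incseq_def\<close>)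
  then obtain m where m: "\<And>k n. n \<ge> m k \<Longrightarrow> L n k = L (m k) k" by metis
  define N' where "N' = Max (insert N (m ` {..<N}))"
  have N': "N' \<ge> N" "\<And>k. k < N \<Longrightarrow> N' \<ge> m k" by (auto simp: N'_def)
  have L_stable: "L n k = L N' k" if n: "n \<ge> N'" for n k
  proof (cases "k < N")
    case True
    then show ?thesis using m[of k n] m[of k N'] N'(2)[OF True] n by simp
  next
    case False
    have *: "L l k = L N N" if "l \<ge> N" for l
    proof
      have "L l k \<subseteq> L (max l k) (max l k)"
        using L_mono1[of l "max l k" k] L_mono2[of k "max l k" "max l k"] by auto
      also have "\<dots> = L N N" using N[of "max l k"] that by auto
      finally show "L l k \<subseteq> L N N" .
      show "L N N \<subseteq> L l k"
        using L_mono1[OF that, of N] L_mono2[of N k l] False by auto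
    qed
    show ?thesis using *[of n] *[of N'] n N'(1) by simp
  qed
  have "J n \<subseteq> J N'" if n: "n \<ge> N'" for n
  proof -
    have "f \<in> J N'" if "f \<in> poly_values S x k" "f \<in> J n" for f k
      using that
    proof (induction k arbitrary: f)
      case 0
      then show ?case using submodule_overD(1)[OF J] by simp
    next
      case (Suc k)
      then obtain c p where c: "c \<in> S" "p \<in> poly_values S x k" "f = c * x ^ k + p" by auto
      then have "c \<in> L n k" using Suc.prems(2) by (auto simp: L_def leading_coeffs_def)
      then have "c \<in> L N' k" using L_stable[OF n] by simp
      then obtain q where q: "q \<in> poly_values S x k" "c * x ^ k + q \<in> J N'"
        by (auto simp: L_def leading_coeffs_def)
      have "f - (c * x ^ k + q) \<in> J n"
        using submodule_overD(2)[OF J Suc.prems(2)] q(2) J_mono[OF n] by blast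
      then have "p - q \<in> J n" by (simp add: c(3))
      then have "p - q \<in> J N'" using Suc.IH poly_values_diff[OF S c(2) q(1)] by blast
      from submodule_overD(4)[OF J this q(2)] show ?case by (simp add: c(3) algebra_simps)
    qed
    then show ?thesis using J_sub[of n] by (auto simp: adjoin_def)
  qed
  then show "\<exists>N. \<forall>n\<ge>N. J n = J N" using J_mono by blast
qed

section \<open>The chain condition in a finitely generated algebra\<close>

context positively_graded_algebra
begin

lemma scale_conv_mult: "kscale c x = kscale c 1 * x"
  using scale_mult[of c 1 x] by simp

lemma scalars_mult: "kscale c 1 * kscale d 1 = kscale (c * d) 1"
  using scale_mult[of c 1 "kscale d 1"] by simp

lemma noetherian_scalars:
  "subring (range (\<lambda>c. kscale c 1))" "noetherian_subring (range (\<lambda>c. kscale c 1))"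
proof -
  let ?S = "range (\<lambda>c. kscale c 1)"
  show "subring ?S"
    unfolding subring_def
    using scale_left_diff_distrib[of _ _ 1, symmetric] scalars_mult
    by (auto intro!: image_eqI[of 1 _ 1])
  show "noetherian_subring ?S"
    unfolding noetherian_subring_def
  proof (intro allI impI)
    fix J assume "(\<forall>n. J n \<subseteq> ?S \<and> submodule_over ?S (J n)) \<and> incseq J"
    then have J_sub: "J n \<subseteq> ?S" and J: "submodule_over ?S (J n)" and "incseq J" for n by auto
    then have J_mono: "n \<le> m \<Longrightarrow> J n \<subseteq> J m" for n m by (auto simp: incseq_def)
    show "\<exists>N. \<forall>n\<ge>N. J n = J N"
    proof (cases "\<forall>n. J n = {0}")
      case False
      then obtain N y where y: "y \<in> J N" "y \<noteq> 0" using submodule_overD(1)[OF J] by blast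
      then obtain c where c: "y = kscale c 1" using J_sub by blast
      then have "c \<noteq> 0" using y by auto
      have "?S \<subseteq> J N"
      proof safe
        fix d
        have "kscale (d / c) 1 * y = kscale d 1"
          using \<open>c \<noteq> 0\<close> by (simp add: c scalars_mult)
        then show "kscale d 1 \<in> J N" using submodule_overD(3)[OF J _ y(1), of "kscale (d/c) 1"] by auto
      qed
      then have "J n = J N" if "n \<ge> N" for n
        using J_sub[of n] J_mono[OF that] by (meson subset_antisym subset_trans)
      then show ?thesis by blast
    qed auto
  qed
qed

lemma noetherian_ring: "noetherian_subring (UNIV :: 'r set)"
proof -
  obtain G where G: "finite G" "subalgebra kscale hull G = UNIV"
    using finitely_generated_algebra by blast
  have "\<exists>S. subring S \<and> noetherian_subring S \<and> range (\<lambda>c. kscale c 1) \<subseteq> S \<and> G \<subseteq> S"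
    using G(1)
  proof (induction G)
    case empty
    then show ?case using noetherian_scalars by blast
  next
    case (insert x G)
    then obtain S where S: "subring S" "noetherian_subring S" "range (\<lambda>c. kscale c 1) \<subseteq> S" "G \<subseteq> S"
      by blast
    show ?case
      using subring_adjoin[OF S(1)] hilbert_basis_adjoin[OF S(1,2)] element_in_adjoin[OF S(1)]
        base_subset_adjoin[of S x] S(3,4)
      by (intro exI[of _ "adjoin S x"]) auto
  qed
  then obtain S where S: "subring S" "noetherian_subring S" "range (\<lambda>c. kscale c 1) \<subseteq> S" "G \<subseteq> S"
    by blast
  have "kscale c y \<in> S" if "y \<in> S" for c y
    using subring_closed(4)[OF S(1) _ that, of "kscale c 1"] S(3)
    by (auto simp: scale_conv_mult[of c y])
  then have "subalgebra kscale S"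
    unfolding subalgebra_def subspace_def using subring_closed[OF S(1)] by auto
  then have "S = UNIV" using hull_minimal[OF S(4), of "subalgebra kscale"] G(2) by auto
  then show ?thesis using S(2) by simp
qed

end

section \<open>Dimensions of images and preimages\<close>

text \<open>
  The map \<open>\<phi>\<close> induces an isomorphism from \<open>V\<close> modulo \<open>{v \<in> V. \<phi> v \<in> U}\<close> onto \<open>W\<close> modulo \<open>U\<close>.
  A basis of \<open>{v \<in> V. \<phi> v \<in> U}\<close> is extended by \<open>C\<close> to a basis of \<open>V\<close>; then \<open>\<phi> ` C\<close> extends a
  basis of \<open>U\<close> to one of \<open>W\<close>. The ambient spaces may be infinite-dimensional.
\<close>

lemma (in vector_space_pair) dim_preimage_sum:
  assumes lin: "Vector_Spaces.linear s1 s2 \<phi>"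
    and V: "vs1.subspace V" and U: "vs2.subspace U"
    and fV: "finite B0" "V \<subseteq> vs1.span B0" and fU: "finite D0" "U \<subseteq> vs2.span D0"
  defines "W \<equiv> {x. \<exists>v\<in>V. x - \<phi> v \<in> U}"
  shows "vs2.dim W + vs1.dim {v \<in> V. \<phi> v \<in> U} = vs2.dim U + vs1.dim V"
    and "\<exists>E. finite E \<and> W \<subseteq> vs2.span E"
proof -
  interpret \<phi>: Vector_Spaces.linear s1 s2 \<phi> by fact
  let ?K = "{v \<in> V. \<phi> v \<in> U}"
  have K: "vs1.subspace ?K"
    using V U by (auto simp: vs1.subspace_def vs2.subspace_def \<phi>.add \<phi>.scale \<phi>.zero)
  obtain B where B: "B \<subseteq> ?K" "vs1.independent B" "?K \<subseteq> vs1.span B" "card B = vs1.dim ?K"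
    by (rule vs1.basis_exists)
  have span_B: "vs1.span B = ?K" using B(1,3) vs1.span_minimal[OF _ K] by blast
  obtain A where A: "B \<subseteq> A" "A \<subseteq> V" "vs1.independent A" "V \<subseteq> vs1.span A"
    using B(1,2) by (auto intro: vs1.maximal_independent_subset_extend[of B V])
  have finA: "finite A" using vs1.independent_span_bound[OF fV(1) A(3)] A(2) fV(2) by blast
  obtain D where D: "D \<subseteq> U" "vs2.independent D" "U \<subseteq> vs2.span D" "card D = vs2.dim U"
    by (rule vs2.basis_exists)
  have finD: "finite D" using vs2.independent_span_bound[OF fU(1) D(2)] D(1) fU(2) by blast
  have span_D: "vs2.span D = U" using D(1,3) vs2.span_minimal[OF _ U] by blast
  define C where "C = A - B"
  have finC: "finite C" using finA by (simp add: C_def)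
  have AC: "A = B \<union> C" "B \<inter> C = {}" using A(1) by (auto simp: C_def)
  have CV: "C \<subseteq> V" using A(2) by (auto simp: C_def)
  have ind: "vs2.independent (D \<union> \<phi> ` C') \<and> card (D \<union> \<phi> ` C') = card D + card C'"
    if "C' \<subseteq> C" for C'
    using finite_subset[OF that finC] that
  proof (induction C')
    case empty
    then show ?case using D(2) by simp
  next
    case (insert c C')
    have "\<phi> c \<notin> vs2.span (D \<union> \<phi> ` C')"
    proof
      assume "\<phi> c \<in> vs2.span (D \<union> \<phi> ` C')"
      then obtain u y where u: "u \<in> vs2.span D" "y \<in> vs2.span (\<phi> ` C')" "\<phi> c = u + y"
        by (auto simp: vs2.span_Un)
      obtain w where w: "w \<in> vs1.span C'" "y = \<phi> w"
        using u(2) \<phi>.span_image[of C'] by auto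
      have "C' \<subseteq> V" using insert.prems CV by auto
      then have "w \<in> V" using w(1) vs1.span_minimal[OF _ V] by blast
      moreover have "c \<in> V" using insert.prems CV by auto
      moreover have "\<phi> (c - w) = u" using u(3) w(2) by (simp add: \<phi>.diff)
      ultimately have "c - w \<in> vs1.span B"
        unfolding span_B using u(1) vs1.subspace_diff[OF V] by (simp add: span_D)
      then have "c - w \<in> vs1.span (B \<union> C')" "w \<in> vs1.span (B \<union> C')"
        using w(1) vs1.span_mono[of B "B \<union> C'"] vs1.span_mono[of C' "B \<union> C'"] by auto
      from vs1.span_add[OF this] have "c \<in> vs1.span (B \<union> C')" by simp
      moreover have "B \<union> C' \<subseteq> A - {c}" using insert AC by auto
      ultimately have "c \<in> vs1.span (A - {c})" using vs1.span_mono by blast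
      then show False using A(3) insert.prems AC by (auto simp: vs1.dependent_def)
    qed
    moreover from this have "\<phi> c \<notin> D \<union> \<phi> ` C'" using vs2.span_base[of "\<phi> c" "D \<union> \<phi> ` C'"] by blast
    ultimately show ?case
      using insert.IH insert.prems insert.hyps finD vs2.independent_insertI[of "\<phi> c" "D \<union> \<phi> ` C'"]
      by simp
  qed
  have span_A: "vs1.span A = V" using A(2,4) vs1.span_minimal[OF _ V] by blast
  have DW: "D \<union> \<phi> ` C \<subseteq> W"
  proof
    fix x assume "x \<in> D \<union> \<phi> ` C"
    then show "x \<in> W"
    proof
      assume "x \<in> D"
      then show ?thesis unfolding W_def using D(1) vs1.subspace_0[OF V]
        by (auto simp: \<phi>.zero intro!: bexI[of _ 0])
    next
      assume "x \<in> \<phi> ` C"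
      then show ?thesis unfolding W_def using CV vs2.subspace_0[OF U] by force
    qed
  qed
  have WD: "W \<subseteq> vs2.span (D \<union> \<phi> ` C)"
  proof
    fix x assume "x \<in> W"
    then obtain v where v: "v \<in> V" "x - \<phi> v \<in> U" by (auto simp: W_def)
    then obtain b c where bc: "b \<in> vs1.span B" "c \<in> vs1.span C" "v = b + c"
      using A(4) by (auto simp: AC(1) vs1.span_Un)
    have "\<phi> b \<in> U" using bc(1) by (simp add: span_B)
    then have "x - \<phi> v + \<phi> b \<in> vs2.span D"
      using vs2.subspace_add[OF U v(2)] by (simp add: span_D)
    moreover have "\<phi> c \<in> vs2.span (\<phi> ` C)" using bc(2) \<phi>.span_image[of C] by auto
    moreover have "x = (x - \<phi> v + \<phi> b) + \<phi> c" by (simp add: bc(3) \<phi>.add)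
    ultimately show "x \<in> vs2.span (D \<union> \<phi> ` C)" unfolding vs2.span_Un by blast
  qed
  have "vs2.dim W = card D + card C"
    using vs2.dim_unique[OF DW WD] ind[OF subset_refl] by blast
  moreover have "vs1.dim V = card A" using vs1.dim_unique[OF A(2,4,3)] by simp
  moreover have "card A = card B + card C"
    using AC finA by (metis card_Un_disjoint finite_Un)
  ultimately show "vs2.dim W + vs1.dim ?K = vs2.dim U + vs1.dim V" using B(4) D(4) by simp
  show "\<exists>E. finite E \<and> W \<subseteq> vs2.span E" using WD finD finC by (intro exI[of _ "D \<union> \<phi> ` C"]) simp
qed

section \<open>Homogeneous components\<close>

definition component :: "('i \<Rightarrow> 'a::ab_group_add set) \<Rightarrow> 'a \<Rightarrow> 'i \<Rightarrow> 'a" where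
  "component A x =
     (THE c. (\<forall>i. c i \<in> A i) \<and> finite {i. c i \<noteq> 0} \<and> x = (\<Sum>i | c i \<noteq> 0. c i))"

lemma component_props:
  assumes "internal_direct_sum A"
  shows component_mem: "component A x i \<in> A i"
    and finite_components: "finite {i. component A x i \<noteq> 0}"
    and sum_components: "x = (\<Sum>i | component A x i \<noteq> 0. component A x i)"
proof -
  have "\<exists>!c. (\<forall>i. c i \<in> A i) \<and> finite {i. c i \<noteq> 0} \<and> x = (\<Sum>i | c i \<noteq> 0. c i)"
    using assms unfolding internal_direct_sum_def by blast
  from theI'[OF this] show "component A x i \<in> A i" "finite {i. component A x i \<noteq> 0}"
    "x = (\<Sum>i | component A x i \<noteq> 0. component A x i)"
    unfolding component_def[symmetric] by blast+
qed

lemma internal_direct_sum_closed: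
  assumes "internal_direct_sum A"
  shows "0 \<in> A i" "x \<in> A i \<Longrightarrow> y \<in> A i \<Longrightarrow> x - y \<in> A i" "x \<in> A i \<Longrightarrow> y \<in> A i \<Longrightarrow> x + y \<in> A i"
proof -
  show 0: "0 \<in> A i" and *: "\<And>x y. x \<in> A i \<Longrightarrow> y \<in> A i \<Longrightarrow> x - y \<in> A i"
    using assms by (auto simp: internal_direct_sum_def)
  show "x \<in> A i \<Longrightarrow> y \<in> A i \<Longrightarrow> x + y \<in> A i"
    using *[of x "0 - y"] *[OF 0, of y] by simp
qed

lemma component_eqI:
  assumes A: "internal_direct_sum A"
    and F: "finite F" "\<And>i. i \<in> F \<Longrightarrow> c i \<in> A i" and x: "x = (\<Sum>i\<in>F. c i)"
  shows "component A x i = (if i \<in> F then c i else 0)"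
proof -
  define c' where "c' i = (if i \<in> F then c i else 0)" for i
  have ex1: "\<exists>!c. (\<forall>i. c i \<in> A i) \<and> finite {i. c i \<noteq> 0} \<and> x = (\<Sum>i | c i \<noteq> 0. c i)"
    using A unfolding internal_direct_sum_def by blast
  have "x = (\<Sum>i | c' i \<noteq> 0. c' i)"
    unfolding x using F(1) by (intro sum.mono_neutral_cong_right) (auto simp: c'_def)
  moreover have "finite {i. c' i \<noteq> 0}"
    by (rule finite_subset[OF _ F(1)]) (auto simp: c'_def)
  moreover have "\<forall>i. c' i \<in> A i"
    using F(2) internal_direct_sum_closed(1)[OF A] by (auto simp: c'_def)
  ultimately have "component A x = c'"
    unfolding component_def using the1_equality[OF ex1] by blast
  then show ?thesis by (simp add: c'_def)
qed

lemma component_homogeneous: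
  assumes "internal_direct_sum A" "x \<in> A i"
  shows "component A x j = (if j = i then x else 0)"
  using component_eqI[OF assms(1), of "{i}" "\<lambda>_. x" x j] assms(2) by auto

lemma component_zero: "internal_direct_sum A \<Longrightarrow> component A 0 i = 0"
  using component_eqI[of A "{}" _ 0 i] by simp

lemma sum_components_superset:
  assumes "internal_direct_sum A" "finite F" "{i. component A x i \<noteq> 0} \<subseteq> F"
  shows "x = (\<Sum>i\<in>F. component A x i)"
  by (subst sum_components[OF assms(1), of x]) (use assms in \<open>auto intro: sum.mono_neutral_left\<close>)

lemma component_add:
  assumes A: "internal_direct_sum A"
  shows "component A (x + y) i = component A x i + component A y i"
proof -
  let ?F = "{i. component A x i \<noteq> 0} \<union> {i. component A y i \<noteq> 0}"
  have fin: "finite ?F" using finite_components[OF A] by simp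
  have "x = (\<Sum>i\<in>?F. component A x i)" "y = (\<Sum>i\<in>?F. component A y i)"
    using sum_components_superset[OF A fin] by auto
  then have "x + y = (\<Sum>i\<in>?F. component A x i + component A y i)" by (simp add: sum.distrib)
  from component_eqI[OF A fin _ this] show ?thesis
    using internal_direct_sum_closed(3)[OF A] component_mem[OF A] by auto
qed

lemma component_diff:
  assumes A: "internal_direct_sum A"
  shows "component A (x - y) i = component A x i - component A y i"
  using component_add[OF A, of "x - y" y i] by simp

lemma component_sum:
  assumes A: "internal_direct_sum A"
  shows "component A (sum f F) i = (\<Sum>j\<in>F. component A (f j) i)"
  by (induction F rule: infinite_finite_induct) (simp_all add: component_zero[OF A] component_add[OF A])

definition graded_subset :: "('i \<Rightarrow> 'a::ab_group_add set) \<Rightarrow> 'a set \<Rightarrow> bool" where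
  "graded_subset A N \<longleftrightarrow> (\<forall>x\<in>N. \<forall>i. component A x i \<in> N)"

text \<open>
  Extending the grading of the ring by zero in negative degrees makes the ring a graded module
  over itself, so that facts about graded modules apply to ideals.
\<close>

definition int_grading :: "(nat \<Rightarrow> 'a::zero set) \<Rightarrow> int \<Rightarrow> 'a set" where
  "int_grading R i = (if i \<ge> 0 then R (nat i) else {0})"

lemma internal_direct_sum_int_grading:
  assumes R: "internal_direct_sum R"
  shows "internal_direct_sum (int_grading R)"
  unfolding internal_direct_sum_def
proof (intro conjI allI)
  fix i show "0 \<in> int_grading R i"
    using internal_direct_sum_closed(1)[OF R] by (simp add: int_grading_def)
  show "\<forall>x\<in>int_grading R i. \<forall>y\<in>int_grading R i. x - y \<in> int_grading R i"
    using internal_direct_sum_closed(2)[OF R] by (simp add: int_grading_def)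
next
  fix x
  let ?P = "\<lambda>c. (\<forall>i. c i \<in> int_grading R i) \<and> finite {i. c i \<noteq> 0} \<and> x = (\<Sum>i | c i \<noteq> 0. c i)"
  define c0 where "c0 i = (if i \<ge> 0 then component R x (nat i) else 0)" for i :: int
  show "\<exists>!c. ?P c"
  proof (rule ex1I[of _ c0])
    let ?F = "{i. component R x i \<noteq> 0}"
    have supp: "{i. c0 i \<noteq> 0} = int ` ?F"
      by (force simp: c0_def image_iff split: if_splits intro: exI[of _ "nat _"])
    have "(\<Sum>i | c0 i \<noteq> 0. c0 i) = (\<Sum>i\<in>?F. c0 (int i))"
      unfolding supp by (subst sum.reindex) auto
    also have "\<dots> = x" using sum_components[OF R, of x] by (simp add: c0_def)
    finally show "?P c0"
      using supp finite_components[OF R, of x] component_mem[OF R, of x]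
        internal_direct_sum_closed(1)[OF R]
      by (auto simp: c0_def int_grading_def)
  next
    fix c assume c: "?P c"
    have neg: "c i = 0" if "i < 0" for i using c that by (auto simp: int_grading_def dest!: spec[of _ i])
    have nonneg: "c (int i) \<in> R i" for i
      using c by (auto simp: int_grading_def dest!: spec[of _ "int i"])
    let ?F = "{i. c (int i) \<noteq> 0}"
    have supp: "{i. c i \<noteq> 0} = int ` ?F"
    proof (intro equalityI subsetI)
      fix i assume "i \<in> {i. c i \<noteq> 0}"
      moreover from this have "i \<ge> 0" using neg[of i] by (cases "i < 0") auto
      ultimately show "i \<in> int ` ?F" by (intro image_eqI[of _ _ "nat i"]) auto
    qed auto
    have "finite (int ` ?F)" using c by (simp add: supp[symmetric])
    then have fin: "finite ?F" by (simp add: finite_image_iff)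
    have "x = (\<Sum>i | c i \<noteq> 0. c i)" using c by blast
    also have "\<dots> = (\<Sum>i\<in>?F. c (int i))" unfolding supp by (subst sum.reindex) auto
    finally have x: "x = (\<Sum>i\<in>?F. c (int i))" .
    have "c i = c0 i" for i
      using component_eqI[OF R fin nonneg x, of "nat i"] neg[of i] by (auto simp: c0_def)
    then show "c = c0" by blast
  qed
qed

section \<open>Colon ideals and cyclic extensions of graded submodules\<close>

lemma module_mult: "module ((*) :: 'r::comm_ring_1 \<Rightarrow> 'r \<Rightarrow> 'r)"
  by unfold_locales (simp_all add: algebra_simps)

interpretation ideal: module "(*) :: 'r::comm_ring_1 \<Rightarrow> 'r \<Rightarrow> 'r"
  by (rule module_mult)

text \<open>
  For a submodule \<open>N\<close>, the cyclic extension \<open>N + R z\<close> modulo \<open>N\<close> is isomorphic to the ring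
  modulo the ideal \<open>colon scale N z\<close>. These two constructions take the place of quotient
  modules in all exact sequences below.
\<close>

definition colon :: "('r \<Rightarrow> 'm \<Rightarrow> 'm) \<Rightarrow> 'm set \<Rightarrow> 'm \<Rightarrow> 'r set" where
  "colon scale N z = {r. scale r z \<in> N}"

definition cyclic_extension :: "('r \<Rightarrow> 'm::ab_group_add \<Rightarrow> 'm) \<Rightarrow> 'm set \<Rightarrow> 'm \<Rightarrow> 'm set" where
  "cyclic_extension scale N z = {x. \<exists>r. x - scale r z \<in> N}"

lemma (in module) subspace_colon:
  assumes "subspace N"
  shows "ideal.subspace (colon scale N z)"
  using assms
  by (auto simp: colon_def ideal.subspace_def scale_left_distrib scale_scale[symmetric]
      intro: subspace_0 subspace_add subspace_scale simp del: scale_scale)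

lemma (in module) subspace_cyclic_extension:
  assumes N: "subspace N"
  shows "subspace (cyclic_extension scale N z)"
proof (rule subspaceI)
  show "0 \<in> cyclic_extension scale N z"
    unfolding cyclic_extension_def using subspace_0[OF N] by (auto intro!: exI[of _ 0])
next
  fix x y assume "x \<in> cyclic_extension scale N z" "y \<in> cyclic_extension scale N z"
  then obtain r s where "x - scale r z \<in> N" "y - scale s z \<in> N"
    by (auto simp: cyclic_extension_def)
  from subspace_add[OF N this] have "x + y - scale (r + s) z \<in> N"
    by (simp add: scale_left_distrib algebra_simps)
  then show "x + y \<in> cyclic_extension scale N z" by (auto simp: cyclic_extension_def)
next
  fix c x assume "x \<in> cyclic_extension scale N z"
  then obtain r where "x - scale r z \<in> N" by (auto simp: cyclic_extension_def)
  from subspace_scale[OF N this, of c] have "scale c x - scale (c * r) z \<in> N"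
    by (simp add: scale_right_diff_distrib)
  then show "scale c x \<in> cyclic_extension scale N z" by (auto simp: cyclic_extension_def)
qed

lemma (in module) cyclic_extension_superset:
  assumes "subspace N"
  shows "N \<subseteq> cyclic_extension scale N z" "z \<in> cyclic_extension scale N z"
  using subspace_0[OF assms] unfolding cyclic_extension_def
  by (auto intro: exI[of _ 0] exI[of _ 1])

abbreviation (in positively_graded_algebra) RI :: "int \<Rightarrow> 'r set" where
  "RI \<equiv> int_grading R"

context positively_graded_algebra
begin

lemma RI_decomposition: "internal_direct_sum RI"
  by (rule internal_direct_sum_int_grading[OF ring_decomposition])

lemma RI_mult: "x \<in> RI i \<Longrightarrow> y \<in> RI j \<Longrightarrow> x * y \<in> RI (i + j)"
  using ring_mult_degree[of x "nat i" y "nat j"] RI_decomposition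
  by (auto simp: int_grading_def nat_add_distrib internal_direct_sum_def split: if_splits)

lemma RI_0: "RI 0 = range (\<lambda>c. kscale c 1)"
  by (simp add: int_grading_def degree_zero)

lemma one_in_RI: "1 \<in> RI 0"
  unfolding RI_0 by (auto intro: image_eqI[of _ _ 1])

lemma subspace_RI: "subspace (RI i)"
proof (rule subspaceI)
  fix c x assume "x \<in> RI i"
  then show "kscale c x \<in> RI i"
    using RI_mult[of "kscale c 1" 0 x i] by (simp add: RI_0 scale_conv_mult[of c x])
qed (use internal_direct_sum_closed[OF RI_decomposition] in auto)

lemma ring_as_module: "fg_graded_module kscale R (*) RI"
proof (unfold_locales)
  show "internal_direct_sum RI" by (rule RI_decomposition)
  show "r * x \<in> RI (int i + j)" if "r \<in> R i" "x \<in> RI j" for r x i j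
    using RI_mult[of r "int i" x j] that by (simp add: int_grading_def)
  have "ideal.span {1 :: 'r} = UNIV"
    using ideal.span_scale[OF ideal.span_base[of "1::'r" "{1}"]] by auto
  then show "\<exists>G. finite G \<and> ideal.span G = (UNIV :: 'r set)" by blast
qed

lemma scalar_mult_eq_scale: "(\<lambda>c. (*) (kscale c 1)) = kscale"
  by (intro ext) (rule scale_conv_mult[symmetric])

end

context fg_graded_module
begin

sublocale MK: vector_space "\<lambda>c. rscale (kscale c 1)"
  by unfold_locales
    (simp_all add: M.scale_right_distrib M.scale_left_distrib scale_left_distrib scalars_mult)

sublocale MKP: vector_space_pair kscale "\<lambda>c. rscale (kscale c 1)" ..

lemma RI_module_mult: "r \<in> RI i \<Longrightarrow> x \<in> M j \<Longrightarrow> rscale r x \<in> M (i + j)"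
  using module_mult_degree[of r "nat i" x j] internal_direct_sum_closed(1)[OF module_decomposition]
  by (auto simp: int_grading_def split: if_splits)

lemma component_scale_homogeneous:
  assumes r: "r \<in> RI i"
  shows "component M (rscale r x) (i + j) = rscale r (component M x j)"
proof -
  let ?F = "{j. component M x j \<noteq> 0}"
  have fin: "finite ?F" by (rule finite_components[OF module_decomposition])
  have x: "x = (\<Sum>j\<in>?F. component M x j)" by (rule sum_components[OF module_decomposition])
  have "component M (rscale r x) (i + j) = component M (\<Sum>j\<in>?F. rscale r (component M x j)) (i + j)"
    by (subst x) (simp only: M.scale_sum_right)
  also have "\<dots> = (\<Sum>l\<in>?F. component M (rscale r (component M x l)) (i + j))"
    by (rule component_sum[OF module_decomposition])
  also have "\<dots> = (\<Sum>l\<in>?F. if l = j then rscale r (component M x l) else 0)"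
    using component_homogeneous[OF module_decomposition
        RI_module_mult[OF r component_mem[OF module_decomposition]]]
    by (intro sum.cong refl) auto
  also have "\<dots> = rscale r (component M x j)" using fin by simp
  finally show ?thesis .
qed

lemma component_scale_homogeneous_right:
  assumes z: "z \<in> M e"
  shows "component M (rscale r z) (i + e) = rscale (component RI r i) z"
proof -
  let ?F = "{i. component RI r i \<noteq> 0}"
  have fin: "finite ?F" by (rule finite_components[OF RI_decomposition])
  have r: "r = (\<Sum>i\<in>?F. component RI r i)" by (rule sum_components[OF RI_decomposition])
  have "component M (rscale r z) (i + e) = component M (\<Sum>i\<in>?F. rscale (component RI r i) z) (i + e)"
    by (subst r) (simp only: M.scale_sum_left)
  also have "\<dots> = (\<Sum>l\<in>?F. component M (rscale (component RI r l) z) (i + e))"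
    by (rule component_sum[OF module_decomposition])
  also have "\<dots> = (\<Sum>l\<in>?F. if l = i then rscale (component RI r l) z else 0)"
    using component_homogeneous[OF module_decomposition
        RI_module_mult[OF component_mem[OF RI_decomposition] z]]
    by (intro sum.cong refl) auto
  also have "\<dots> = rscale (component RI r i) z" using fin by simp
  finally show ?thesis .
qed

lemma graded_colon:
  assumes N: "graded_subset M N" and z: "z \<in> M e"
  shows "graded_subset RI (colon rscale N z)"
  using N component_scale_homogeneous_right[OF z, symmetric]
  by (auto simp: graded_subset_def colon_def)

lemma graded_cyclic_extension:
  assumes N: "graded_subset M N" and z: "z \<in> M e"
  shows "graded_subset M (cyclic_extension rscale N z)"
  unfolding graded_subset_def
proof (intro ballI allI)
  fix x i assume "x \<in> cyclic_extension rscale N z"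
  then obtain r where "x - rscale r z \<in> N" by (auto simp: cyclic_extension_def)
  then have "component M (x - rscale r z) i \<in> N" using N by (auto simp: graded_subset_def)
  then have "component M x i - rscale (component RI r (i - e)) z \<in> N"
    using component_scale_homogeneous_right[OF z, of r "i - e"]
    by (simp add: component_diff[OF module_decomposition])
  then show "component M x i \<in> cyclic_extension rscale N z" by (auto simp: cyclic_extension_def)
qed

lemma subspace_M: "MK.subspace (M i)"
proof (rule MK.subspaceI)
  fix c x assume "x \<in> M i"
  then show "rscale (kscale c 1) x \<in> M i"
    using RI_module_mult[of "kscale c 1" 0 x i] by (simp add: RI_0)
qed (use internal_direct_sum_closed[OF module_decomposition] in auto)

lemma subspace_over_field: "M.subspace N \<Longrightarrow> MK.subspace N"
  by (auto simp: M.subspace_def MK.subspace_def)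

text \<open>
  The isomorphism of \<open>(N + R z) / N\<close> with the ring modulo the colon ideal, shifted by the degree
  of \<open>z\<close>, counted in degree \<open>n\<close>. The second claim carries finite-dimensionality along when
  generators are added one by one.
\<close>

lemma dim_cyclic_extension:
  assumes N: "M.subspace N" "graded_subset M N" and z: "z \<in> M e"
    and finR: "finite B" "RI (n - e) \<subseteq> span B"
    and finN: "finite D" "N \<inter> M n \<subseteq> MK.span D"
  shows "MK.dim (cyclic_extension rscale N z \<inter> M n) + dim (colon rscale N z \<inter> RI (n - e))
      = MK.dim (N \<inter> M n) + dim (RI (n - e))"
    and "\<exists>E. finite E \<and> cyclic_extension rscale N z \<inter> M n \<subseteq> MK.span E"
proof -
  have deg: "rscale v z \<in> M n" if "v \<in> RI (n - e)" for v
    using RI_module_mult[OF that z] by simp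
  have lin: "Vector_Spaces.linear kscale (\<lambda>c. rscale (kscale c 1)) (\<lambda>r. rscale r z)"
    unfolding Vector_Spaces.linear_iff
    using vector_space_axioms MK.vector_space_axioms
    by (simp add: M.scale_left_distrib scale_conv_mult[symmetric])
  have ext: "cyclic_extension rscale N z \<inter> M n = {x. \<exists>v\<in>RI (n - e). x - rscale v z \<in> N \<inter> M n}"
  proof (intro equalityI subsetI)
    fix x assume x: "x \<in> cyclic_extension rscale N z \<inter> M n"
    then obtain r where "x - rscale r z \<in> N" by (auto simp: cyclic_extension_def)
    then have "component M (x - rscale r z) n \<in> N" using N(2) by (auto simp: graded_subset_def)
    then have "x - rscale (component RI r (n - e)) z \<in> N"
      using component_scale_homogeneous_right[OF z, of r "n - e"] x
      by (simp add: component_diff[OF module_decomposition] component_homogeneous[OF module_decomposition, of x n])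
    moreover have "component RI r (n - e) \<in> RI (n - e)" by (rule component_mem[OF RI_decomposition])
    ultimately show "x \<in> {x. \<exists>v\<in>RI (n - e). x - rscale v z \<in> N \<inter> M n}"
      using deg x internal_direct_sum_closed(2)[OF module_decomposition] by auto
  next
    fix x assume "x \<in> {x. \<exists>v\<in>RI (n - e). x - rscale v z \<in> N \<inter> M n}"
    then obtain v where v: "v \<in> RI (n - e)" "x - rscale v z \<in> N" "x - rscale v z \<in> M n" by auto
    then show "x \<in> cyclic_extension rscale N z \<inter> M n"
      using internal_direct_sum_closed(3)[OF module_decomposition v(3) deg[OF v(1)]]
      by (auto simp: cyclic_extension_def)
  qed
  have col: "colon rscale N z \<inter> RI (n - e) = {v \<in> RI (n - e). rscale v z \<in> N \<inter> M n}"
    using deg by (auto simp: colon_def)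
  have sub: "MK.subspace (N \<inter> M n)"
    using subspace_over_field[OF N(1)] subspace_M by (rule MK.subspace_inter)
  note * = MKP.dim_preimage_sum[OF lin subspace_RI sub finR finN]
  show "MK.dim (cyclic_extension rscale N z \<inter> M n) + dim (colon rscale N z \<inter> RI (n - e))
      = MK.dim (N \<inter> M n) + dim (RI (n - e))"
    unfolding ext col by (rule *(1))
  show "\<exists>E. finite E \<and> cyclic_extension rscale N z \<inter> M n \<subseteq> MK.span E"
    unfolding ext by (rule *(2))
qed

end

section \<open>Finite-dimensionality of the graded pieces\<close>

context positively_graded_algebra
begin

text \<open>
  The degree \<open>n\<close> part of the ideal generated by a subset of \<open>RI n\<close> is the linear span of that
  subset, because only scalars act within one degree. Hence an infinite linearly independent
  sequence in \<open>RI n\<close> would generate a strictly increasing chain of ideals.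
\<close>

lemma graded_piece_finite_dimensional: "\<exists>B. finite B \<and> RI n \<subseteq> span B"
proof (rule ccontr)
  assume neg: "\<not> ?thesis"
  interpret S: fg_graded_module kscale R "(*)" RI by (rule ring_as_module)
  have "\<exists>x. x \<in> RI n \<and> x \<notin> span B" if "finite B" for B
    using neg that by blast
  then obtain pick where pick: "\<And>B. finite B \<Longrightarrow> pick B \<in> RI n \<and> pick B \<notin> span B" by metis
  define B where "B = rec_nat {} (\<lambda>_ B. insert (pick B) B)"
  have B_simps: "B 0 = {}" "B (Suc k) = insert (pick (B k)) (B k)" for k by (simp_all add: B_def)
  have B: "finite (B k) \<and> B k \<subseteq> RI n" for k
    by (induction k) (use pick B_simps in auto)
  have "incseq B" by (rule incseq_SucI) (auto simp: B_simps)
  define J where "J k = ideal.span (B k)" for k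
  have "incseq J"
    using \<open>incseq B\<close> ideal.span_mono unfolding J_def incseq_def by blast
  moreover have "submodule_over UNIV (J k)" for k
    unfolding submodule_over_def J_def
    by (auto intro: ideal.span_zero ideal.span_diff ideal.span_scale)
  ultimately obtain N where N: "\<And>k. k \<ge> N \<Longrightarrow> J k = J N"
    using noetherian_ring unfolding noetherian_subring_def by blast
  have comp: "component RI y n \<in> span (B N)" if "y \<in> J N" for y
    using that unfolding J_def
  proof (induction rule: ideal.span_induct_alt)
    case base
    then show ?case by (simp add: component_zero[OF RI_decomposition] span_zero)
  next
    case (step c x y)
    then have "x \<in> RI n" using B by blast
    from S.component_scale_homogeneous_right[OF this, of c 0]
    have "component RI (c * x) n = component RI c 0 * x" by simp
    moreover obtain k where "component RI c 0 = kscale k 1"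
      using component_mem[OF RI_decomposition, of c 0] by (auto simp: RI_0)
    ultimately have "component RI (c * x) n = kscale k x" by (simp add: scale_conv_mult[of k x])
    then show ?case
      using step by (simp add: component_add[OF RI_decomposition] span_add span_scale span_base)
  qed
  have "pick (B N) \<in> J (Suc N)" unfolding J_def B_simps by (rule ideal.span_base) simp
  then have "pick (B N) \<in> J N" using N[of "Suc N"] by simp
  from comp[OF this] show False
    using pick[of "B N"] B component_homogeneous[OF RI_decomposition, of "pick (B N)" n n] by simp
qed

end

section \<open>Chains of prime ideals\<close>

definition prime_chain :: "'r::comm_ring_1 set \<Rightarrow> nat \<Rightarrow> bool" where
  "prime_chain A l \<longleftrightarrow> (\<exists>P :: nat \<Rightarrow> 'r set.
     (\<forall>i\<le>l. prime_ideal (P i) \<and> A \<subseteq> P i) \<and> (\<forall>i<l. P i \<subset> P (Suc i)))"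

lemma krull_dim_prime_chain:
  "krull_dim scale N z = (SUP l \<in> {l. prime_chain (annihilator scale N z) l}. ereal (real l))"
  by (simp add: krull_dim_def prime_chain_def)

lemma prime_chain_transfer:
  assumes "prime_chain A l" "\<And>P. prime_ideal P \<Longrightarrow> A \<subseteq> P \<Longrightarrow> B \<subseteq> P"
  shows "prime_chain B l"
  using assms unfolding prime_chain_def by blast

lemma prime_chain_antimono: "prime_chain B l \<Longrightarrow> A \<subseteq> B \<Longrightarrow> prime_chain A l"
  by (erule prime_chain_transfer) blast

lemma prime_chain_0: "prime_ideal P \<Longrightarrow> A \<subseteq> P \<Longrightarrow> prime_chain A 0"
  unfolding prime_chain_def by auto

lemma prime_chain_Suc:
  assumes P: "prime_ideal P" "A \<subseteq> P" and B: "prime_chain B l"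
    and above: "\<And>Q. prime_ideal Q \<Longrightarrow> B \<subseteq> Q \<Longrightarrow> P \<subset> Q"
  shows "prime_chain A (Suc l)"
proof -
  obtain Q where Q: "\<And>i. i \<le> l \<Longrightarrow> prime_ideal (Q i) \<and> B \<subseteq> Q i" "\<And>i. i < l \<Longrightarrow> Q i \<subset> Q (Suc i)"
    using B unfolding prime_chain_def by blast
  define Q' where "Q' i = (case i of 0 \<Rightarrow> P | Suc j \<Rightarrow> Q j)" for i
  have "prime_ideal (Q' i) \<and> A \<subseteq> Q' i" if "i \<le> Suc l" for i
    using that P Q(1) above by (cases i) (auto simp: Q'_def, blast)
  moreover have "Q' i \<subset> Q' (Suc i)" if "i < Suc l" for i
    using that Q above by (cases i) (auto simp: Q'_def)
  ultimately show ?thesis unfolding prime_chain_def by blast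
qed

lemma prime_idealD:
  assumes "prime_ideal P"
  shows "ideal.subspace P" "x * y \<in> P \<Longrightarrow> x \<in> P \<or> y \<in> P"
  using assms by (auto simp: prime_ideal_def)

lemma ideal_mult_left: "ideal.subspace J \<Longrightarrow> y \<in> J \<Longrightarrow> x * y \<in> J"
  by (rule ideal.subspace_scale)

lemma ideal_mult_right: "ideal.subspace J \<Longrightarrow> x \<in> J \<Longrightarrow> x * y \<in> (J :: 'r::comm_ring_1 set)"
  using ideal.subspace_scale[of J x y] by (simp add: mult.commute)

lemma root_of_unity_coprime_power:
  assumes "\<zeta> ^ p = 1" "\<zeta> ^ i = (1 :: 'a::comm_ring_1)" "i > 0" "gcd i p = 1"
  shows "\<zeta> = 1"
proof -
  obtain x y where "i * x = p * y + gcd i p" using bezout_nat[of i p] assms(3) by auto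
  then have "\<zeta> ^ (i * x) = \<zeta> ^ (p * y) * \<zeta>" using assms(4) by (simp add: power_add)
  then show ?thesis using assms(1,2) by (simp add: power_mult)
qed

section \<open>Homogeneous prime ideals\<close>

context positively_graded_algebra
begin

lemma ideal_noetherian_induct [consumes 1, case_names larger]:
  assumes "ideal.subspace J"
    and step: "\<And>J. ideal.subspace J \<Longrightarrow> (\<And>J'. ideal.subspace J' \<Longrightarrow> J \<subset> J' \<Longrightarrow> P J') \<Longrightarrow> P J"
  shows "P (J :: 'r set)"
proof -
  let ?r = "{(J', J :: 'r set). ideal.subspace J' \<and> ideal.subspace J \<and> J \<subset> J'}"
  have "wf ?r"
    unfolding wf_iff_no_infinite_down_chain
  proof
    assume "\<exists>f. \<forall>i. (f (Suc i), f i) \<in> ?r"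
    then obtain f where "\<And>i. (f (Suc i), f i) \<in> ?r" by blast
    then have f: "ideal.subspace (f i)" "f i \<subset> f (Suc i)" for i by simp_all
    have "incseq f" using f(2) by (intro incseq_SucI) blast
    moreover have "submodule_over UNIV (f i)" for i
      using ideal.subspace_0[OF f(1)] ideal.subspace_diff[OF f(1)] ideal.subspace_scale[OF f(1)]
      by (simp add: submodule_over_def)
    ultimately obtain N where "\<And>n. n \<ge> N \<Longrightarrow> f n = f N"
      using noetherian_ring unfolding noetherian_subring_def by blast
    from this[of "Suc N"] show False using f(2)[of N] by simp
  qed
  then show ?thesis using assms(1)
  proof (induction J)
    case (less J)
    show ?case by (rule step) (use less in auto)
  qed
qed

lemma homogeneous_components_in_ideal:
  assumes "ideal.subspace J" "\<And>i. component RI x i \<in> J"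
  shows "x \<in> J"
  by (subst sum_components[OF RI_decomposition, of x])
    (rule ideal.subspace_sum[OF assms(1)], rule assms(2))

lemma top_component_outside:
  assumes J: "ideal.subspace J" and x: "x \<notin> J"
  obtains i where "component RI x i \<notin> J" "\<And>p. p > i \<Longrightarrow> component RI x p \<in> J"
proof -
  let ?F = "{p. component RI x p \<notin> J}"
  have fin: "finite ?F"
    by (rule finite_subset[OF _ finite_components[OF RI_decomposition, of x]])
      (use ideal.subspace_0[OF J] in auto)
  have "?F \<noteq> {}" using homogeneous_components_in_ideal[OF J] x by blast
  then have "component RI x (Max ?F) \<notin> J" using Max_in[OF fin] by simp
  moreover have "component RI x p \<in> J" if "p > Max ?F" for p
    using Max_ge[OF fin, of p] that by force
  ultimately show ?thesis by (rule that)
qed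

text \<open>
  If \<open>x y \<in> J\<close> with \<open>x, y \<notin> J\<close>, then in the degree \<open>i + j\<close>, where \<open>i\<close> and \<open>j\<close> are the largest
  degrees of components outside \<open>J\<close>, all products of components except the one for \<open>(i, j)\<close> lie
  in \<open>J\<close>. So primality can be tested on homogeneous elements.
\<close>

lemma graded_prime_ideal:
  assumes J: "ideal.subspace J" "graded_subset RI J" "J \<noteq> UNIV"
    and hom: "\<And>a b i j. a \<in> RI i \<Longrightarrow> b \<in> RI j \<Longrightarrow> a * b \<in> J \<Longrightarrow> a \<in> J \<or> b \<in> J"
  shows "prime_ideal J"
  unfolding prime_ideal_def
proof (intro conjI allI impI)
  interpret S: fg_graded_module kscale R "(*)" RI by (rule ring_as_module)
  fix x y assume xy: "x * y \<in> J"
  show "x \<in> J \<or> y \<in> J"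
  proof (rule ccontr)
    assume "\<not> (x \<in> J \<or> y \<in> J)"
    then obtain i j where i: "component RI x i \<notin> J" "\<And>p. p > i \<Longrightarrow> component RI x p \<in> J"
      and j: "component RI y j \<notin> J" "\<And>p. p > j \<Longrightarrow> component RI y p \<in> J"
      using top_component_outside[OF J(1)] by metis
    let ?F = "{p. component RI x p \<noteq> 0}"
    let ?t = "\<lambda>p. component RI x p * component RI y (i + j - p)"
    have fin: "finite ?F" by (rule finite_components[OF RI_decomposition])
    have iF: "i \<in> ?F" using i(1) ideal.subspace_0[OF J(1)] by auto
    have "x * y = (\<Sum>p\<in>?F. component RI x p * y)"
      by (subst sum_components[OF RI_decomposition, of x]) (rule sum_distrib_right)
    then have "component RI (x * y) (i + j) = (\<Sum>p\<in>?F. component RI (component RI x p * y) (i + j))"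
      by (simp only: component_sum[OF RI_decomposition])
    also have "\<dots> = (\<Sum>p\<in>?F. ?t p)"
    proof (intro sum.cong refl)
      fix p show "component RI (component RI x p * y) (i + j) = ?t p"
        using S.component_scale_homogeneous[OF component_mem[OF RI_decomposition, of x p], of y "i + j - p"]
        by simp
    qed
    also have "\<dots> = component RI x i * component RI y j + (\<Sum>p\<in>?F - {i}. ?t p)"
      by (subst sum.remove[OF fin iF]) simp
    finally have eq: "component RI x i * component RI y j
        = component RI (x * y) (i + j) - (\<Sum>p\<in>?F - {i}. ?t p)" by simp
    have "?t p \<in> J" if "p \<noteq> i" for p
      using that i(2)[of p] j(2)[of "i + j - p"] ideal_mult_left[OF J(1)] ideal_mult_right[OF J(1)]
      by (cases "p > i") auto
    then have "(\<Sum>p\<in>?F - {i}. ?t p) \<in> J" by (intro ideal.subspace_sum[OF J(1)]) auto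
    moreover have "component RI (x * y) (i + j) \<in> J" using J(2) xy by (auto simp: graded_subset_def)
    ultimately have "component RI x i * component RI y j \<in> J"
      unfolding eq by (rule ideal.subspace_diff[OF J(1), rotated])
    then show False
      using hom[OF component_mem[OF RI_decomposition] component_mem[OF RI_decomposition]] i(1) j(1)
      by blast
  qed
qed (use J in auto)

text \<open>
  The ideal generated by all homogeneous elements of positive degree; it is the unique maximal
  graded ideal, with residue field the field of scalars.
\<close>

definition irrelevant_ideal :: "'r set" where
  "irrelevant_ideal = {x. component RI x 0 = 0}"

lemma degree_zero_component_mult:
  "component RI (x * y) 0 = component RI x 0 * component RI y 0"
proof -
  interpret S: fg_graded_module kscale R "(*)" RI by (rule ring_as_module)
  let ?F = "insert 0 {p. component RI x p \<noteq> 0}"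
  have fin: "finite ?F" using finite_components[OF RI_decomposition, of x] by simp
  have "x * y = (\<Sum>p\<in>?F. component RI x p * y)"
    by (subst sum_components_superset[OF RI_decomposition fin, of x])
      (auto simp only: sum_distrib_right)
  then have "component RI (x * y) 0 = (\<Sum>p\<in>?F. component RI (component RI x p * y) 0)"
    by (simp only: component_sum[OF RI_decomposition])
  also have "\<dots> = (\<Sum>p\<in>?F. component RI x p * component RI y (- p))"
  proof (intro sum.cong refl)
    fix p show "component RI (component RI x p * y) 0 = component RI x p * component RI y (- p)"
      using S.component_scale_homogeneous[OF component_mem[OF RI_decomposition, of x p], of y "- p"]
      by simp
  qed
  also have "\<dots> = (\<Sum>p\<in>?F. if p = 0 then component RI x 0 * component RI y 0 else 0)"
  proof (intro sum.cong refl)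
    fix p
    have neg: "component RI z q = 0" if "q < 0" for z q
      using component_mem[OF RI_decomposition, of z q] that by (simp add: int_grading_def)
    show "component RI x p * component RI y (- p)
        = (if p = 0 then component RI x 0 * component RI y 0 else 0)"
      using neg[of p x] neg[of "- p" y] by (cases p "0 :: int" rule: linorder_cases) auto
  qed
  also have "\<dots> = component RI x 0 * component RI y 0" using fin by simp
  finally show ?thesis .
qed

lemma prime_irrelevant_ideal: "prime_ideal irrelevant_ideal"
  unfolding prime_ideal_def
proof (intro conjI allI impI)
  show "ideal.subspace irrelevant_ideal"
    by (rule ideal.subspaceI)
      (auto simp: irrelevant_ideal_def component_zero[OF RI_decomposition]
        component_add[OF RI_decomposition] degree_zero_component_mult)
  have "component RI 1 0 = 1"
    using component_homogeneous[OF RI_decomposition one_in_RI, of 0] by simp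
  then have "1 \<notin> irrelevant_ideal" by (simp add: irrelevant_ideal_def)
  then show "irrelevant_ideal \<noteq> UNIV" by blast
next
  fix x y assume "x * y \<in> irrelevant_ideal"
  moreover obtain c d where "component RI x 0 = kscale c 1" "component RI y 0 = kscale d 1"
    using component_mem[OF RI_decomposition, of _ 0] unfolding RI_0 by (metis imageE)
  ultimately show "x \<in> irrelevant_ideal \<or> y \<in> irrelevant_ideal"
    by (auto simp: irrelevant_ideal_def degree_zero_component_mult scalars_mult)
qed

lemma positive_degree_irrelevant: "x \<in> RI i \<Longrightarrow> i > 0 \<Longrightarrow> x \<in> irrelevant_ideal"
  using component_homogeneous[OF RI_decomposition, of x i 0] by (simp add: irrelevant_ideal_def)

lemma proper_graded_ideal_irrelevant:
  assumes J: "ideal.subspace J" "graded_subset RI J" "J \<noteq> UNIV"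
  shows "J \<subseteq> irrelevant_ideal"
proof
  fix x assume "x \<in> J"
  then have xJ: "component RI x 0 \<in> J" using J(2) by (auto simp: graded_subset_def)
  obtain c where c: "component RI x 0 = kscale c 1"
    using component_mem[OF RI_decomposition, of x 0] by (auto simp: RI_0)
  have "c = 0"
  proof (rule ccontr)
    assume "c \<noteq> 0"
    then have "kscale (1 / c) 1 * component RI x 0 = 1" by (simp add: c scalars_mult)
    then have "1 \<in> J" using ideal_mult_left[OF J(1) xJ] by metis
    then have "y \<in> J" for y using ideal_mult_left[OF J(1), of 1 y] by simp
    then show False using J(3) by blast
  qed
  then show "x \<in> irrelevant_ideal" by (simp add: irrelevant_ideal_def c)
qed

lemma coprime_degree_ideal_irrelevant: "coprime_degree_ideal R p \<subseteq> irrelevant_ideal"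
  unfolding coprime_degree_ideal_def
proof (rule ideal.span_minimal)
  show "{x. \<exists>i>0. x \<in> R i \<and> gcd i p = 1} \<subseteq> irrelevant_ideal"
  proof safe
    fix x i assume "i > 0" "x \<in> R i"
    then show "x \<in> irrelevant_ideal"
      using positive_degree_irrelevant[of x "int i"] by (simp add: int_grading_def)
  qed
qed (rule prime_idealD(1)[OF prime_irrelevant_ideal])

section \<open>Pole orders of graded quotient rings\<close>

text \<open>
  The Hilbert function of the ring modulo \<open>J\<close>, for a graded ideal \<open>J\<close>.
\<close>

definition quotient_hilbert :: "'r set \<Rightarrow> int \<Rightarrow> complex" where
  "quotient_hilbert J n = of_nat (dim (RI n)) - of_nat (dim (J \<inter> RI n))"

lemma quotient_hilbert_exact:
  assumes J: "ideal.subspace J" "graded_subset RI J" and z: "z \<in> RI e"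
  shows "quotient_hilbert J n
    = quotient_hilbert (colon (*) J z) (n - e) + quotient_hilbert (cyclic_extension (*) J z) n"
proof -
  interpret S: fg_graded_module kscale R "(*)" RI by (rule ring_as_module)
  obtain B where B: "finite B" "RI (n - e) \<subseteq> span B" using graded_piece_finite_dimensional by blast
  obtain D where D: "finite D" "RI n \<subseteq> span D" using graded_piece_finite_dimensional by blast
  have "dim (cyclic_extension (*) J z \<inter> RI n) + dim (colon (*) J z \<inter> RI (n - e))
      = dim (J \<inter> RI n) + dim (RI (n - e))"
    using S.dim_cyclic_extension(1)[OF J z B D(1)] D(2)
    by (simp add: scalar_mult_eq_scale le_infI2)
  then have "(of_nat (dim (cyclic_extension (*) J z \<inter> RI n) + dim (colon (*) J z \<inter> RI (n - e))) :: complex)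
      = of_nat (dim (J \<inter> RI n) + dim (RI (n - e)))" by (rule arg_cong)
  then show ?thesis by (simp add: quotient_hilbert_def algebra_simps)
qed

text \<open>
  The core of the proof, by Noetherian induction on \<open>J\<close>. Write \<open>I\<close> for the ideal generated by the
  homogeneous elements of degree prime to \<open>p\<close>.

  If \<open>J\<close> is not prime, there are homogeneous \<open>a, b \<notin> J\<close> with \<open>a b \<in> J\<close>, and the exact sequence for
  multiplication by \<open>a\<close> reduces \<open>R / J\<close> to two quotients by strictly larger ideals. If \<open>J\<close> is prime,
  a homogeneous \<open>x \<notin> J\<close> of degree \<open>e\<close> is a nonzerodivisor on \<open>R / J\<close>, so that the series of
  \<open>R / (J + x R)\<close> is \<open>1 - t ^ e\<close> times that of \<open>R / J\<close>. When \<open>x\<close> can be chosen with \<open>e\<close> prime to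
  \<open>p\<close>, the factor does not vanish at \<open>\<zeta>\<close> and the order does not change. Otherwise \<open>J\<close> contains
  \<open>I\<close>; passing to \<open>J + x R\<close> then lowers the order by at most one, and it shortens chains of primes
  above \<open>J\<close> by at least one because \<open>J\<close> itself can be put below them. When no \<open>x\<close> of positive
  degree exists, \<open>R / J\<close> is concentrated in degree \<open>0\<close> and has no pole.
\<close>

lemma pole_order_quotient_le_chain_length:
  assumes J: "ideal.subspace J" and "graded_subset RI J"
    and z: "\<zeta> ^ p = 1" "\<zeta> \<noteq> 1"
    and "\<And>l. prime_chain (J \<union> coprime_degree_ideal R p) l \<Longrightarrow> l \<le> k"
  shows "pole_order_le \<zeta> k (quotient_hilbert J)"
  using J assms(2,5)
proof (induction J arbitrary: k rule: ideal_noetherian_induct)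
  case (larger J)
  interpret S: fg_graded_module kscale R "(*)" RI by (rule ring_as_module)
  let ?I = "coprime_degree_ideal R p"
  note J = larger.hyps larger.prems(1)
  have IH: "pole_order_le \<zeta> k' (quotient_hilbert J')"
    if "ideal.subspace J'" "graded_subset RI J'" "J \<subset> J'"
      "\<And>l. prime_chain (J' \<union> ?I) l \<Longrightarrow> l \<le> k'" for J' k'
    using larger.IH[OF that(1,3,2,4)] .
  have chain_larger: "l \<le> k" if "prime_chain (J' \<union> ?I) l" "J \<subset> J'" for J' l
    using larger.prems(2)[OF prime_chain_antimono[OF that(1)]] that(2) by blast
  have ext: "ideal.subspace (cyclic_extension (*) J x)" "graded_subset RI (cyclic_extension (*) J x)"
    "J \<subset> cyclic_extension (*) J x" if "x \<in> RI i" "x \<notin> J" for x i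
    using ideal.subspace_cyclic_extension[OF J(1), of x] S.graded_cyclic_extension[OF J(2) that(1)]
      ideal.cyclic_extension_superset[OF J(1), of x] that(2) by auto
  consider "J = UNIV"
    | a b i j where "a \<in> RI i" "b \<in> RI j" "a * b \<in> J" "a \<notin> J" "b \<notin> J"
    | "prime_ideal J" "J \<noteq> UNIV"
    using graded_prime_ideal[OF J] by blast
  then show ?case
  proof cases
    case 1
    then show ?thesis by (intro pole_order_le_eventually_zero) (simp add: quotient_hilbert_def)
  next
    case 2
    let ?C = "colon (*) J a" and ?E = "cyclic_extension (*) J a"
    have C: "ideal.subspace ?C" "graded_subset RI ?C"
      using ideal.subspace_colon[OF J(1)] S.graded_colon[OF J(2) 2(1)] by auto
    have "J \<subset> ?C"
      using 2(3,5) ideal_mult_right[OF J(1)] by (auto simp: colon_def mult.commute)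
    then have "pole_order_le \<zeta> k (quotient_hilbert ?C)" using IH[OF C] chain_larger by blast
    moreover have "pole_order_le \<zeta> k (quotient_hilbert ?E)"
      using IH[OF ext[OF 2(1,4)]] chain_larger ext(3)[OF 2(1,4)] by blast
    ultimately have "pole_order_le \<zeta> k (\<lambda>n. quotient_hilbert ?C (n - i) + quotient_hilbert ?E n)"
      by (intro pole_order_le_add pole_order_le_shift)
    then show ?thesis using quotient_hilbert_exact[OF J 2(1)] by presburger
  next
    case 3
    have colon_J: "colon (*) J x = J" if "x \<notin> J" for x
      using prime_idealD(2)[OF 3(1)] that ideal_mult_right[OF J(1)] by (auto simp: colon_def)
    have diff: "quotient_hilbert J n - quotient_hilbert J (n - e)
        = quotient_hilbert (cyclic_extension (*) J x) n" if "x \<in> RI e" "x \<notin> J" for x e n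
      using quotient_hilbert_exact[OF J that(1), of n] by (simp add: colon_J[OF that(2)])
    consider (coprime) x e where "x \<in> R e" "x \<notin> J" "e > 0" "gcd e p = 1"
      | (other) x e where "x \<in> R e" "x \<notin> J" "e > 0" "?I \<subseteq> J"
      | (irrelevant) "\<And>x e. x \<in> R e \<Longrightarrow> e > 0 \<Longrightarrow> x \<in> J"
    proof -
      have "?I \<subseteq> J" if "\<And>x e. x \<in> R e \<Longrightarrow> e > 0 \<Longrightarrow> gcd e p = 1 \<Longrightarrow> x \<in> J"
        unfolding coprime_degree_ideal_def using that by (intro ideal.span_minimal J) auto
      then show ?thesis using that by metis
    qed
    then show ?thesis
    proof cases
      case coprime
      have x: "x \<in> RI (int e)" using coprime(1) by (simp add: int_grading_def)
      have "\<zeta> ^ e \<noteq> 1" using root_of_unity_coprime_power[OF z(1) _ coprime(3,4)] z(2) by blast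
      moreover have "pole_order_le \<zeta> k (quotient_hilbert (cyclic_extension (*) J x))"
        using IH[OF ext[OF x coprime(2)]] chain_larger ext(3)[OF x coprime(2)] by blast
      ultimately show ?thesis
        using pole_order_le_difference[of \<zeta> k "quotient_hilbert J" e] by (simp add: diff[OF x coprime(2)])
    next
      case other
      let ?E = "cyclic_extension (*) J x"
      have x: "x \<in> RI (int e)" using other(1) by (simp add: int_grading_def)
      note E = ext[OF x other(2)]
      have chain: "Suc l \<le> k" if "prime_chain (?E \<union> ?I) l" for l
      proof (rule larger.prems(2)[OF prime_chain_Suc[OF 3(1) _ that]])
        show "J \<union> ?I \<subseteq> J" using other(4) by blast
        show "J \<subset> Q" if "?E \<union> ?I \<subseteq> Q" for Q using E(3) that by blast
      qed
      have "?E \<subseteq> irrelevant_ideal"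
      proof
        fix y assume "y \<in> ?E"
        then obtain r where r: "y - r * x \<in> J" by (auto simp: cyclic_extension_def)
        note sub = prime_idealD(1)[OF prime_irrelevant_ideal]
        have "y - r * x \<in> irrelevant_ideal"
          using r proper_graded_ideal_irrelevant[OF J 3(2)] by blast
        moreover have "r * x \<in> irrelevant_ideal"
          using positive_degree_irrelevant[OF x] other(3) ideal_mult_left[OF sub] by simp
        ultimately show "y \<in> irrelevant_ideal" using ideal.subspace_add[OF sub] by force
      qed
      \<comment> \<open>a prime above \<open>?E \<union> ?I\<close> exists, so \<open>k\<close> is positive and can be decreased\<close>
      then have "prime_chain (?E \<union> ?I) 0"
        using prime_chain_0[OF prime_irrelevant_ideal, of "?E \<union> ?I"]
          coprime_degree_ideal_irrelevant[of p] by simp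
      then obtain k' where k: "k = Suc k'" using chain[of 0] by (cases k) auto
      have "pole_order_le \<zeta> k' (quotient_hilbert ?E)" using IH[OF E] chain by (simp add: k)
      then show ?thesis
        using pole_order_le_difference_Suc[of \<zeta> k' "quotient_hilbert J" e] other(3)
        by (simp add: diff[OF x other(2)] k)
    next
      case irrelevant
      have "quotient_hilbert J n = 0" if "n \<ge> 1" for n
      proof -
        have "RI n \<subseteq> J" using irrelevant[of _ "nat n"] that by (auto simp: int_grading_def)
        then show ?thesis by (simp add: quotient_hilbert_def Int_absorb1)
      qed
      then show ?thesis
        by (intro pole_order_le_eventually_zero) (auto simp: eventually_at_top_linorder)
    qed
  qed
qed

end

section \<open>Pole orders of graded modules\<close>

context fg_graded_module
begin

lemma annihilator_subspace: "ideal.subspace (annihilator rscale UNIV 0)"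
  by (auto simp: annihilator_def ideal.subspace_def M.scale_left_distrib M.scale_scale[symmetric]
      simp del: M.scale_scale)

lemma annihilator_graded: "graded_subset RI (annihilator rscale UNIV 0)"
  unfolding graded_subset_def
proof (intro ballI allI)
  fix r i assume r: "r \<in> annihilator rscale UNIV 0"
  have "rscale (component RI r i) x = 0" for x
  proof -
    have "rscale (component RI r i) (component M x e) = 0" for e
      using component_scale_homogeneous_right[OF component_mem[OF module_decomposition], of r x e i] r
      by (simp add: annihilator_def component_zero[OF module_decomposition])
    then show ?thesis
      by (subst sum_components[OF module_decomposition, of x]) (simp add: M.scale_sum_right)
  qed
  then show "component RI r i \<in> annihilator rscale UNIV 0" by (simp add: annihilator_def)
qed

lemma homogeneous_generators:
  obtains F where "finite F" "F \<subseteq> (\<Union>i. M i)" "M.span F = UNIV"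
proof -
  obtain G where G: "finite G" "M.span G = UNIV" using finitely_generated_module by blast
  define F where "F = (\<Union>g\<in>G. component M g ` {i. component M g i \<noteq> 0})"
  have "finite F" using G(1) finite_components[OF module_decomposition] by (simp add: F_def)
  moreover have "F \<subseteq> (\<Union>i. M i)" using component_mem[OF module_decomposition] by (auto simp: F_def)
  moreover have "g \<in> M.span F" if "g \<in> G" for g
    by (subst sum_components[OF module_decomposition, of g])
      (rule M.span_sum, rule M.span_base, use that in \<open>auto simp: F_def\<close>)
  then have "M.span F = UNIV" using M.span_minimal[OF _ M.subspace_span, of G F] G(2) by auto
  ultimately show ?thesis by (rule that)
qed

text \<open>
  Adding homogeneous generators one by one filters the module by shifted quotients of the ring by
  ideals that contain the annihilator of the module.
\<close>

lemma pole_order_hilbert_function_le_chain_length: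
  assumes z: "\<zeta> ^ p = 1" "\<zeta> \<noteq> 1"
    and chain: "\<And>l. prime_chain (annihilator rscale UNIV 0 \<union> coprime_degree_ideal R p) l \<Longrightarrow> l \<le> k"
  shows "pole_order_le \<zeta> k (\<lambda>n. of_nat (hilbert_function kscale rscale M n))"
proof -
  have gen: "graded_subset M (M.span F) \<and> (\<forall>n. \<exists>D. finite D \<and> M.span F \<inter> M n \<subseteq> MK.span D)
      \<and> pole_order_le \<zeta> k (\<lambda>n. of_nat (MK.dim (M.span F \<inter> M n)))"
    if "finite F" "F \<subseteq> (\<Union>i. M i)" for F
    using that
  proof (induction F)
    case empty
    have "{0} \<inter> M n = {0}" for n using internal_direct_sum_closed(1)[OF module_decomposition] by auto
    moreover have "MK.dim {0} = 0" by (rule MK.dim_unique[of "{}"]) (auto simp: MK.independent_empty)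
    ultimately show ?case
      by (auto simp: graded_subset_def component_zero[OF module_decomposition]
          intro: pole_order_le_eventually_zero exI[of _ "{}"])
  next
    case (insert z F)
    let ?N = "M.span F" and ?J = "colon rscale (M.span F) z"
    obtain e where e: "z \<in> M e" using insert.prems by blast
    have N: "M.subspace ?N" "graded_subset M ?N" using insert by auto
    have span: "M.span (insert z F) = cyclic_extension rscale ?N z"
      unfolding M.span_insert cyclic_extension_def ..
    have fin: "\<exists>D. finite D \<and> ?N \<inter> M n \<subseteq> MK.span D" for n using insert by auto
    note dims = dim_cyclic_extension[OF N e]
    have eq: "(of_nat (MK.dim (M.span (insert z F) \<inter> M n)) :: complex)
        = of_nat (MK.dim (?N \<inter> M n)) + quotient_hilbert ?J (n - e)" for n
    proof -
      obtain B D where "finite B" "RI (n - e) \<subseteq> span B" "finite D" "?N \<inter> M n \<subseteq> MK.span D"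
        using graded_piece_finite_dimensional[of "n - e"] fin[of n] by blast
      from arg_cong[OF dims(1)[OF this], of "of_nat :: nat \<Rightarrow> complex"]
      show ?thesis unfolding span by (simp add: quotient_hilbert_def algebra_simps)
    qed
    have "annihilator rscale UNIV 0 \<subseteq> ?J"
      by (auto simp: annihilator_def colon_def M.span_zero)
    then have "pole_order_le \<zeta> k (quotient_hilbert ?J)"
      using pole_order_quotient_le_chain_length[OF M.subspace_colon[OF N(1)] graded_colon[OF N(2) e] z]
        chain prime_chain_antimono by blast
    then have "pole_order_le \<zeta> k (\<lambda>n. of_nat (MK.dim (M.span (insert z F) \<inter> M n)))"
      unfolding eq using insert by (intro pole_order_le_add pole_order_le_shift) auto
    moreover have "\<exists>D. finite D \<and> M.span (insert z F) \<inter> M n \<subseteq> MK.span D" for n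
    proof -
      obtain B D where "finite B" "RI (n - e) \<subseteq> span B" "finite D" "?N \<inter> M n \<subseteq> MK.span D"
        using graded_piece_finite_dimensional[of "n - e"] fin[of n] by blast
      from dims(2)[OF this] show ?thesis unfolding span .
    qed
    ultimately show ?case using graded_cyclic_extension[OF N(2) e] by (simp add: span)
  qed
  obtain F where F: "finite F" "F \<subseteq> (\<Union>i. M i)" "M.span F = UNIV" by (rule homogeneous_generators)
  show ?thesis using gen[OF F(1,2)] F(3) by (simp add: hilbert_function_def)
qed

section \<open>The Krull dimension of the quotient module\<close>

lemma annihilator_quotient:
  "annihilator (quotient_scale rscale N) (quotient_carrier N) N = {r. \<forall>x. rscale r x \<in> N}"
  if N: "M.subspace N"
proof -
  have "rscale r x +o N = N \<longleftrightarrow> rscale r x \<in> N" for r x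
  proof
    assume "rscale r x +o N = N"
    then show "rscale r x \<in> N" using M.subspace_0[OF N] by (force simp: elt_set_plus_def)
  next
    assume rx: "rscale r x \<in> N"
    have "y \<in> rscale r x +o N" if "y \<in> N" for y
      using M.subspace_diff[OF N that rx] by (auto simp: elt_set_plus_def intro!: bexI[of _ "y - rscale r x"])
    then show "rscale r x +o N = N"
      using M.subspace_add[OF N rx] by (auto simp: elt_set_plus_def)
  qed
  then show ?thesis
    by (auto simp: annihilator_def quotient_carrier_def
        quotient_scale_coset[OF M.module_axioms N])
qed

text \<open>
  A form of Nakayama's lemma: the support of \<open>M / I M\<close> is the part of the support of \<open>M\<close> above
  \<open>I\<close>. If \<open>r \<notin> P\<close> maps \<open>M\<close> into \<open>I M\<close>, then generators can be eliminated one after another: as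
  long as \<open>s \<notin> P\<close> maps \<open>M\<close> into the span of \<open>g\<close> and \<open>F\<close>, the element \<open>s r\<close> maps \<open>g\<close> to \<open>i g\<close>
  modulo the span of \<open>F\<close> for some \<open>i \<in> I\<close>, and \<open>(s r - i) s \<notin> P\<close> maps \<open>M\<close> into the span of \<open>F\<close>.
  In the end an element outside \<open>P\<close> annihilates \<open>M\<close>.
\<close>

lemma prime_contains_annihilator_quotient:
  assumes P: "prime_ideal P" and ann: "annihilator rscale UNIV 0 \<subseteq> P"
    and I: "ideal.subspace I" "I \<subseteq> P"
    and r: "\<And>x. rscale r x \<in> ideal_times_module rscale I"
  shows "r \<in> P"
proof (rule ccontr)
  assume rP: "r \<notin> P"
  have kill: "\<exists>s. s \<notin> P \<and> (\<forall>x. rscale s x = 0)"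
    if "finite F" "s \<notin> P" "\<And>x. rscale s x \<in> M.span F" for F s
    using that
  proof (induction F arbitrary: s)
    case empty
    then show ?case by auto
  next
    case (insert g F)
    have sx: "\<exists>c. rscale s x - rscale c g \<in> M.span F" for x
      using insert.prems(2)[of x] by (simp add: M.span_insert)
    have "\<exists>i\<in>I. rscale s y - rscale i g \<in> M.span F" if "y \<in> ideal_times_module rscale I" for y
      using that unfolding ideal_times_module_def
    proof (induction rule: M.span_induct_alt)
      case base
      then show ?case using ideal.subspace_0[OF I(1)] by (auto simp: M.span_zero intro!: bexI[of _ 0])
    next
      case (step c x y)
      then obtain i x' where i: "i \<in> I" "x = rscale i x'" by auto
      obtain d where d: "rscale s x' - rscale d g \<in> M.span F" using sx by blast
      obtain j where j: "j \<in> I" "rscale s y - rscale j g \<in> M.span F" using step by blast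
      have "rscale s (rscale c x) = rscale (c * i) (rscale s x')" by (simp only: i(2) M.scale_scale mult_ac)
      moreover have "rscale (c * d * i + j) g = rscale (c * i) (rscale d g) + rscale j g"
        by (simp only: M.scale_left_distrib M.scale_scale mult_ac)
      ultimately have "rscale s (rscale c x + y) - rscale (c * d * i + j) g
          = rscale (c * i) (rscale s x' - rscale d g) + (rscale s y - rscale j g)"
        by (simp only: M.scale_right_distrib M.scale_right_diff_distrib add_diff_add)
      also have "\<dots> \<in> M.span F" using M.span_add[OF M.span_scale[OF d] j(2)] .
      finally show ?case
        using ideal.subspace_add[OF I(1) ideal_mult_left[OF I(1) i(1), of "c * d"] j(1)] by blast
    qed
    then obtain i where i: "i \<in> I" "rscale s (rscale r g) - rscale i g \<in> M.span F"
      using r by blast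
    define t where "t = s * r - i"
    have tg: "rscale t g \<in> M.span F" using i(2) by (simp add: t_def M.scale_left_diff_distrib)
    have "t \<notin> P"
    proof
      assume "t \<in> P"
      then have "t + i \<in> P" using i(1) I(2) ideal.subspace_add[OF prime_idealD(1)[OF P]] by blast
      then show False using prime_idealD(2)[OF P, of s r] rP insert.prems(1) by (simp add: t_def)
    qed
    then have "t * s \<notin> P" using prime_idealD(2)[OF P] insert.prems(1) by blast
    moreover have "rscale (t * s) x \<in> M.span F" for x
    proof -
      obtain c where c: "rscale s x - rscale c g \<in> M.span F" using sx by blast
      have "rscale (t * s) x = rscale t (rscale s x - rscale c g) + rscale c (rscale t g)"
        by (simp add: M.scale_right_diff_distrib mult.commute)
      then show ?thesis using M.span_add[OF M.span_scale[OF c] M.span_scale[OF tg]] by simp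
    qed
    ultimately show ?case by (rule insert.IH)
  qed
  obtain G where "finite G" "M.span G = UNIV" using finitely_generated_module by blast
  moreover have "1 \<notin> P"
    using P ideal_mult_left[OF prime_idealD(1)[OF P], of 1] by (auto simp: prime_ideal_def)
  ultimately obtain s where "s \<notin> P" "\<And>x. rscale s x = 0" using kill[of G 1] by auto
  then show False using ann by (auto simp: annihilator_def)
qed

lemma krull_dim_quotient_ge_chain_length:
  assumes I: "ideal.subspace I" and chain: "prime_chain (annihilator rscale UNIV 0 \<union> I) l"
  shows "ereal (real l) \<le> krull_dim_quotient rscale (ideal_times_module rscale I)"
proof -
  let ?N = "ideal_times_module rscale I"
  have "M.subspace ?N" by (simp add: ideal_times_module_def)
  note ann = annihilator_quotient[OF this]
  have "prime_chain {r. \<forall>x. rscale r x \<in> ?N} l"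
    using chain
  proof (rule prime_chain_transfer)
    fix P assume P: "prime_ideal P" "annihilator rscale UNIV 0 \<union> I \<subseteq> P"
    then show "{r. \<forall>x. rscale r x \<in> ?N} \<subseteq> P"
      using prime_contains_annihilator_quotient[OF P(1) _ I] by auto
  qed
  then show ?thesis
    unfolding krull_dim_quotient_def krull_dim_prime_chain ann by (intro SUP_upper) simp
qed

text \<open>
  The module is nonzero, so its annihilator is a proper graded ideal.
\<close>

lemma irrelevant_ideal_chain:
  assumes "krull_dim rscale UNIV 0 \<noteq> - \<infinity>"
  shows "prime_chain (annihilator rscale UNIV 0 \<union> coprime_degree_ideal R p) 0"
proof -
  have "\<exists>l. prime_chain (annihilator rscale UNIV 0) l"
  proof (rule ccontr)
    assume "\<not> ?thesis"
    then show False using assms by (simp add: krull_dim_prime_chain bot_ereal_def)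
  qed
  then have "annihilator rscale UNIV 0 \<noteq> UNIV"
    by (fastforce simp: prime_chain_def prime_ideal_def)
  then show ?thesis
    using prime_chain_0[OF prime_irrelevant_ideal, of "annihilator rscale UNIV 0 \<union> coprime_degree_ideal R p"]
      coprime_degree_ideal_irrelevant[of p]
      proper_graded_ideal_irrelevant[OF annihilator_subspace annihilator_graded] by simp
qed

end

section \<open>Period and grade of a quasi-polynomial\<close>

lemma periodic_multiple:
  fixes f :: "int \<Rightarrow> 'a"
  assumes "\<And>n. f (n + p) = f n"
  shows "f (n + k * p) = f n"
proof (induction k rule: int_induct[where k = 0])
  case (step1 k)
  then show ?case using assms[of "n + k * p"] by (simp add: algebra_simps)
next
  case (step2 k)
  then show ?case using assms[of "n + (k - 1) * p"] by (simp add: algebra_simps)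
qed simp

lemma qp_period_is_period:
  assumes "quasi_polynomial u a Q"
  shows "qp_period u a > 0" "int i \<le> u \<Longrightarrow> a i (n + m * int (qp_period u a)) = a i n"
proof -
  have "\<forall>i. \<exists>p. int i \<le> u \<longrightarrow> p > 0 \<and> (\<forall>n. a i (n + p) = a i n)"
    using assms unfolding quasi_polynomial_def by blast
  then obtain p where "\<forall>i. int i \<le> u \<longrightarrow> p i > 0 \<and> (\<forall>n. a i (n + p i) = a i n)"
    unfolding choice_iff by blast
  then have p: "\<And>i. int i \<le> u \<Longrightarrow> p i > 0" "\<And>i n. int i \<le> u \<Longrightarrow> a i (n + p i) = a i n"
    by auto
  let ?F = "{i. int i \<le> u}"
  have fin: "finite ?F" by (rule finite_subset[of _ "{..nat u}"]) auto
  define q where "q = (\<Prod>i\<in>?F. nat (p i))"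
  have "q > 0" using p(1) by (auto simp: q_def intro: prod_pos)
  moreover have "a i (n + m * int q) = a i n" if "int i \<le> u" for i n m
  proof -
    have "nat (p i) dvd q" unfolding q_def using that fin by (intro dvd_prodI) auto
    then obtain k where "q = nat (p i) * k" by blast
    then have eq: "m * int q = m * int k * p i" using p(1)[OF that] by simp
    show ?thesis unfolding eq by (rule periodic_multiple) (rule p(2)[OF that])
  qed
  ultimately have "q > 0 \<and> (\<forall>i n m. int i \<le> u \<longrightarrow> a i (n + m * int q) = a i n)" by blast
  then have "qp_period u a > 0 \<and>
      (\<forall>i n m. int i \<le> u \<longrightarrow> a i (n + m * int (qp_period u a)) = a i n)"
    unfolding qp_period_def by (rule LeastI)
  then show "qp_period u a > 0" "int i \<le> u \<Longrightarrow> a i (n + m * int (qp_period u a)) = a i n"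
    by auto
qed

text \<open>
  The least number in the definition of the grade exists because \<open>u\<close> itself qualifies and the
  candidates are bounded below; \<open>int k - 1\<close> transfers the question to natural numbers. By
  minimality the coefficient at the grade is not constant.
\<close>

lemma qp_grade_props:
  assumes "u \<ge> -1"
  shows "qp_grade u a \<ge> -1"
    and "qp_grade u a < int i \<Longrightarrow> int i \<le> u \<Longrightarrow> \<exists>c. \<forall>n. a i n = c"
    and "int \<delta> = qp_grade u a \<Longrightarrow> int \<delta> \<le> u \<and> \<not> (\<exists>c. \<forall>n. a \<delta> n = c)"
proof -
  define P where "P \<delta> \<longleftrightarrow> \<delta> \<ge> -1 \<and> (\<forall>i. \<delta> < int i \<and> int i \<le> u \<longrightarrow> (\<exists>c. \<forall>n. a i n = c))" for \<delta>
  define m where "m = (LEAST k. P (int k - 1))"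
  have ge: "P \<delta> \<Longrightarrow> \<delta> = int (nat (\<delta> + 1)) - 1" for \<delta> by (auto simp: P_def)
  have "P u" using assms by (auto simp: P_def)
  then have m: "P (int m - 1)" unfolding m_def using ge[of u] by (metis (mono_tags, lifting) LeastI)
  have min: "int m - 1 \<le> \<delta>" if "P \<delta>" for \<delta>
  proof -
    have "m \<le> nat (\<delta> + 1)" unfolding m_def by (rule Least_le) (use ge[OF that] that in simp)
    then show ?thesis using ge[OF that] by linarith
  qed
  have g: "qp_grade u a = int m - 1"
    unfolding qp_grade_def P_def[symmetric] using m min by (rule Least_equality)
  show "qp_grade u a \<ge> -1"
    and "qp_grade u a < int i \<Longrightarrow> int i \<le> u \<Longrightarrow> \<exists>c. \<forall>n. a i n = c"
    using m unfolding g P_def by auto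
  show "int \<delta> \<le> u \<and> \<not> (\<exists>c. \<forall>n. a \<delta> n = c)" if \<delta>: "int \<delta> = qp_grade u a"
  proof (rule ccontr)
    assume neg: "\<not> ?thesis"
    have "P (int \<delta> - 1)"
      unfolding P_def
    proof (intro conjI allI impI)
      fix i assume i: "int \<delta> - 1 < int i \<and> int i \<le> u"
      show "\<exists>c. \<forall>n. a i n = c"
      proof (cases "i = \<delta>")
        case True
        then show ?thesis using neg i by blast
      next
        case False
        then show ?thesis using i m \<delta> unfolding g P_def by force
      qed
    qed simp
    from min[OF this] show False using \<delta> g by linarith
  qed
qed

section \<open>The grade bound\<close>

theorem theorem2:
  fixes kscale :: "'k::field \<Rightarrow> 'r::comm_ring_1 \<Rightarrow> 'r"
    and R :: "nat \<Rightarrow> 'r set"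
    and rscale :: "'r \<Rightarrow> 'm::ab_group_add \<Rightarrow> 'm"
    and M :: "int \<Rightarrow> 'm set"
    and d \<pi> :: nat
    and a :: "nat \<Rightarrow> int \<Rightarrow> complex"
    and Q :: "int \<Rightarrow> complex"
    and I :: "'r set"
  assumes "fg_graded_module kscale R rscale M"
    and "krull_dim rscale UNIV 0 = ereal (real d)"
    and "is_hilbert_quasi_polynomial kscale rscale M (int d - 1) a Q"
    and "\<pi> = qp_period (int d - 1) a"
    and "I = coprime_degree_ideal R \<pi>"
  shows "ereal (real_of_int (qp_grade (int d - 1) a))
           < krull_dim_quotient rscale (ideal_times_module rscale I)"
proof -
  interpret fg_graded_module kscale R rscale M by fact
  let ?A = "annihilator rscale UNIV 0" and ?D = "krull_dim_quotient rscale (ideal_times_module rscale I)"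
  let ?u = "int d - 1"
  have I: "ideal.subspace I" by (simp add: assms(5) coprime_degree_ideal_def)
  have dim_ge: "ereal (real l) \<le> ?D" if "prime_chain (?A \<union> I) l" for l
    using krull_dim_quotient_ge_chain_length[OF I that] .
  have qp: "quasi_polynomial ?u a Q"
    and hilb: "\<forall>\<^sub>F n in at_top. of_nat (hilbert_function kscale rscale M n) = Q n"
    using assms(3) by (auto simp: is_hilbert_quasi_polynomial_def)
  have u: "?u \<ge> -1" by simp
  note grade = qp_grade_props[OF u, where a = a]
  show ?thesis
  proof (cases "qp_grade ?u a = -1")
    case True
    have "prime_chain (?A \<union> I) 0"
      unfolding assms(5) by (rule irrelevant_ideal_chain) (simp add: assms(2))
    have "ereal (real_of_int (- 1)) < ereal (real 0)" by simp
    also have "\<dots> \<le> ?D" by (rule dim_ge) fact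
    finally show ?thesis unfolding True .
  next
    case False
    then obtain \<delta> where \<delta>: "int \<delta> = qp_grade ?u a" 
      using that[of "nat (qp_grade ?u a)"] grade(1) by force
    have \<delta>u: "int \<delta> \<le> ?u" and nonconst: "\<not> (\<exists>c. \<forall>n. a \<delta> n = c)" using grade(3)[OF \<delta>] by auto
    have le_u: "int i \<le> ?u \<longleftrightarrow> i \<le> d - 1" for i using \<delta>u by linarith
    have indices: "{i. int i \<le> ?u} = {..d - 1}" using le_u by blast
    have Q: "Q n = (\<Sum>i\<le>d - 1. a i n * of_int n ^ i)" for n
      using qp unfolding quasi_polynomial_def indices by blast
    have "\<exists>\<zeta>. \<zeta> ^ \<pi> = 1 \<and> \<zeta> \<noteq> 1 \<and> \<not> pole_order_le \<zeta> \<delta> (\<lambda>n. \<Sum>i\<le>d - 1. a i n * of_int n ^ i)"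
    proof (rule nonconstant_coefficient_gives_pole)
      show "\<pi> > 0" using qp_period_is_period(1)[OF qp] assms(4) by simp
      show "a i (n - int \<pi>) = a i n" if "i \<le> d - 1" for i n
        using qp_period_is_period(2)[OF qp iffD2[OF le_u that], of n "-1"] assms(4) by simp
      show "a i n = a i m" if "\<delta> < i" "i \<le> d - 1" for i n m
        using grade(2)[of i] that by (metis \<delta> le_u of_nat_less_iff)
    qed (use \<delta>u nonconst le_u in auto)
    then obtain \<zeta> where \<zeta>: "\<zeta> ^ \<pi> = 1" "\<zeta> \<noteq> 1" "\<not> pole_order_le \<zeta> \<delta> Q"
      using Q[abs_def] by auto
    have "\<not> pole_order_le \<zeta> \<delta> (\<lambda>n. of_nat (hilbert_function kscale rscale M n))"
      using pole_order_le_cong[OF hilb] \<zeta>(3) by blast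
    \<comment> \<open>if all these chains had length at most \<open>\<delta>\<close>, the pole at \<open>\<zeta>\<close> would have order at most \<open>\<delta>\<close>\<close>
    then obtain l where l: "prime_chain (?A \<union> I) l" "\<not> l \<le> \<delta>"
      using pole_order_hilbert_function_le_chain_length[OF \<zeta>(1,2)] assms(5) by blast
    have "ereal (real_of_int (qp_grade ?u a)) < ereal (real l)" using l(2) by (simp add: \<delta>[symmetric])
    also have "\<dots> \<le> ?D" by (rule dim_ge[OF l(1)])
    finally show ?thesis .
  qed
qed

end
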